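(* Let $T=T((m_1,k_1),\dots,(m_l,k_l);p)$ and $S=T((n_1,r_1),\dots,(n_l,r_l);q)$ be two trees of diameter 4. Suppose that $\frac{m_i}{n_i}=\frac{m_j}{n_j}$ for all $i,j=1,\dots,l$. Then $\mathbb{G}(T)$ is commensurable to $\mathbb{G}(S)$.
   Context: For a finite simplicial graph $\Gamma$, $\mathbb{G}(\Gamma)$ is the right-angled Artin group with generators the vertices of $\Gamma$ and relations $[u,v]=1$ for each edge. Two groups are commensurable if they have isomorphic finite index subgroups. Encoding of trees of diameter 4: in a finite tree of diameter 4 the middle vertex of any path of length 4 is the same vertex $c$, the center; leaves adjacent to $c$ are hair vertices; other neighbours of $c$ are pivots. $T((d_1,k_1),\dots,(d_l,k_l);q)$ is the tree of diameter 4 with exactly $q\ge0$ hair vertices and, for each $i$, exactly $k_i$ pivots adjacent to exactly $d_i$ leaves, where $l,d_i,k_i$ are positive integers, $d_1<\dots<d_l$, and either $l\ge2$ or ($l=1$ and $k_1\ge2$). *)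

theory Defs
  imports "HOL-Algebra.Algebra"
begin

text \<open>A finite simplicial graph is given by a finite vertex set V and a symmetric,
irreflexive edge relation E on V. Words are lists of letters (v, b) with v in V,
where b = True means v and b = False means v inverse.\<close>

definition simple_graph :: "'a set \<Rightarrow> ('a \<Rightarrow> 'a \<Rightarrow> bool) \<Rightarrow> bool" where
  "simple_graph V E \<longleftrightarrow> finite V \<and> (\<forall>x y. E x y \<longrightarrow> x \<in> V \<and> y \<in> V \<and> x \<noteq> y \<and> E y x)"

definition raag_words :: "'a set \<Rightarrow> ('a \<times> bool) list set" where
  "raag_words V = {w. set w \<subseteq> V \<times> UNIV}"

inductive raag_step :: "('a \<Rightarrow> 'a \<Rightarrow> bool) \<Rightarrow> ('a \<times> bool) list \<Rightarrow> ('a \<times> bool) list \<Rightarrow> bool"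
  for E where
  cancel: "raag_step E (u @ [(x, b), (x, \<not> b)] @ v) (u @ v)"
| comm: "E x y \<Longrightarrow> raag_step E (u @ [(x, b), (y, c)] @ v) (u @ [(y, c), (x, b)] @ v)"

definition raag_rel :: "'a set \<Rightarrow> ('a \<Rightarrow> 'a \<Rightarrow> bool) \<Rightarrow> (('a \<times> bool) list \<times> ('a \<times> bool) list) set" where
  "raag_rel V E = {(w, w'). w \<in> raag_words V \<and> w' \<in> raag_words V \<and> (equivclp (raag_step E)) w w'}"

definition RAAG :: "'a set \<Rightarrow> ('a \<Rightarrow> 'a \<Rightarrow> bool) \<Rightarrow> ('a \<times> bool) list set monoid" where
  "RAAG V E = \<lparr> carrier = raag_words V // raag_rel V E,
               monoid.mult = (\<lambda>A B. raag_rel V E `` {a @ b | a b. a \<in> A \<and> b \<in> B}),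
               one = raag_rel V E `` {[]} \<rparr>"

definition commensurable :: "('a, 'c) monoid_scheme \<Rightarrow> ('b, 'd) monoid_scheme \<Rightarrow> bool" where
  "commensurable G H \<longleftrightarrow>
     (\<exists>A B. subgroup A G \<and> subgroup B H \<and> finite (rcosets\<^bsub>G\<^esub> A) \<and> finite (rcosets\<^bsub>H\<^esub> B)
        \<and> G\<lparr>carrier := A\<rparr> \<cong> H\<lparr>carrier := B\<rparr>)"

text \<open>Concrete model of T((d_1,k_1),...,(d_l,k_l); q), indices shifted to 0-based:
center c, hair vertices Hair j (j < q), pivots Pivot i j (i < l, j < k i), and
leaves Leaf i j t (t < d i) adjacent to Pivot i j.\<close>
datatype tvert = Center | Hair nat | Pivot nat nat | Leaf nat nat nat

definition tree4_vertices :: "nat \<Rightarrow> (nat \<Rightarrow> nat) \<Rightarrow> (nat \<Rightarrow> nat) \<Rightarrow> nat \<Rightarrow> tvert set" where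
  "tree4_vertices l d k q =
     {Center} \<union> {Hair j | j. j < q} \<union> {Pivot i j | i j. i < l \<and> j < k i}
     \<union> {Leaf i j t | i j t. i < l \<and> j < k i \<and> t < d i}"

definition tree4_adj0 :: "nat \<Rightarrow> (nat \<Rightarrow> nat) \<Rightarrow> (nat \<Rightarrow> nat) \<Rightarrow> nat \<Rightarrow> tvert \<Rightarrow> tvert \<Rightarrow> bool" where
  "tree4_adj0 l d k q x y \<longleftrightarrow>
     (x = Center \<and> (\<exists>j. j < q \<and> y = Hair j))
   \<or> (x = Center \<and> (\<exists>i j. i < l \<and> j < k i \<and> y = Pivot i j))
   \<or> (\<exists>i j t. i < l \<and> j < k i \<and> t < d i \<and> x = Pivot i j \<and> y = Leaf i j t)"

definition tree4_adj :: "nat \<Rightarrow> (nat \<Rightarrow> nat) \<Rightarrow> (nat \<Rightarrow> nat) \<Rightarrow> nat \<Rightarrow> tvert \<Rightarrow> tvert \<Rightarrow> bool" where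
  "tree4_adj l d k q x y \<longleftrightarrow> tree4_adj0 l d k q x y \<or> tree4_adj0 l d k q y x"

definition tree4_params :: "nat \<Rightarrow> (nat \<Rightarrow> nat) \<Rightarrow> (nat \<Rightarrow> nat) \<Rightarrow> bool" where
  "tree4_params l d k \<longleftrightarrow> 0 < l \<and> (\<forall>i<l. 0 < d i \<and> 0 < k i)
     \<and> (\<forall>i j. i < j \<and> j < l \<longrightarrow> d i < d j) \<and> (2 \<le> l \<or> (l = 1 \<and> 2 \<le> k 0))"

definition tree4_RAAG :: "nat \<Rightarrow> (nat \<Rightarrow> nat) \<Rightarrow> (nat \<Rightarrow> nat) \<Rightarrow> nat \<Rightarrow> (tvert \<times> bool) list set monoid" where
  "tree4_RAAG l d k q = RAAG (tree4_vertices l d k q) (tree4_adj l d k q)"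

end

theory Submission
  imports Defs "HOL-Combinatorics.Permutations"
begin

text \<open>Both groups contain, with finite index, the group of one and the same tree of diameter 4. Such
  subgroups come from two kinds of cyclic covers, whose groups are identified by
  Reidemeister--Schreier rewriting. The kernel of the map to \<open>\<int>/b\<close> sending the center to 1 and all other
  vertices to 0 belongs to the tree in which every number of leaves is multiplied by \<open>b\<close>; since
  \<open>m i / n i\<close> is constant, this makes the leaf numbers of the two trees equal. If instead all members
  of a set \<open>A\<close> of neighbours of the center are sent to 1, the kernel belongs to the tree in which the
  neighbours outside \<open>A\<close> occur \<open>b\<close> times as often, those in \<open>A\<close> as often as before, and
  \<open>(b - 1) (|A| - 1)\<close> new hairs appear. If \<open>A\<close> omits only the pivots of one type, just their number and
  the number of hairs change. So the numbers of pivots of type \<open>i\<close> can be raised to \<open>k i * r i\<close> in both trees.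
  Each such cover multiplies by \<open>b\<close> the number of neighbours of the center minus one, and this
  invariant is balanced by one more cover with \<open>A\<close> the set of all neighbours.\<close>

section \<open>Words modulo the defining relations\<close>

text \<open>The vertex set does not enter here: membership in \<open>raag_words V\<close> matters
  only once classes are formed, so computations with words carry no side conditions.\<close>

definition raag_eq :: "('a \<Rightarrow> 'a \<Rightarrow> bool) \<Rightarrow> ('a \<times> bool) list \<Rightarrow> ('a \<times> bool) list \<Rightarrow> bool" where
  "raag_eq E = equivclp (raag_step E)"

definition winv :: "('a \<times> bool) list \<Rightarrow> ('a \<times> bool) list" where
  "winv w = rev (map (map_prod id Not) w)"

lemma winv_Nil [simp]: "winv [] = []"
  and winv_append [simp]: "winv (u @ v) = winv v @ winv u"
  and winv_Cons: "winv (x # v) = winv v @ [(fst x, \<not> snd x)]"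
  and winv_single [simp]: "winv [(a, b)] = [(a, \<not> b)]"
  by (auto simp: winv_def map_prod_def split: prod.splits)

lemma winv_winv [simp]: "winv (winv w) = w"
  by (induction w) (auto simp: winv_Cons)

lemma fst_set_winv [simp]: "fst ` set (winv w) = fst ` set w"
  by (force simp: winv_def)

lemma raag_words_iff: "w \<in> raag_words V \<longleftrightarrow> fst ` set w \<subseteq> V"
  by (auto simp: raag_words_def)

lemma raag_words_simps [simp]:
  "[] \<in> raag_words V"
  "x # w \<in> raag_words V \<longleftrightarrow> fst x \<in> V \<and> w \<in> raag_words V"
  "u @ v \<in> raag_words V \<longleftrightarrow> u \<in> raag_words V \<and> v \<in> raag_words V"
  "winv w \<in> raag_words V \<longleftrightarrow> w \<in> raag_words V"
  by (auto simp: raag_words_iff)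

lemma raag_eq_refl [simp, intro]: "raag_eq E w w"
  by (simp add: raag_eq_def)

lemma raag_eq_sym: "raag_eq E u v \<Longrightarrow> raag_eq E v u"
  unfolding raag_eq_def by (rule equivclp_sym)

lemma raag_eq_trans [trans]: "raag_eq E u v \<Longrightarrow> raag_eq E v w \<Longrightarrow> raag_eq E u w"
  unfolding raag_eq_def by (rule equivclp_trans)

lemma raag_eq_induct [consumes 1, case_names step refl sym trans]:
  assumes "raag_eq E u v"
    and step: "\<And>u v. raag_step E u v \<Longrightarrow> P u v"
    and refl: "\<And>u. P u u" and sym: "\<And>u v. P u v \<Longrightarrow> P v u"
    and trans: "\<And>u v w. P u v \<Longrightarrow> P v w \<Longrightarrow> P u w"
  shows "P u v"
  using assms(1) unfolding raag_eq_def
proof (induction rule: equivclp_induct)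
  case base
  show ?case by (rule refl)
next
  case (step y z)
  then show ?case using assms by blast
qed

lemma raag_step_context: "raag_step E u v \<Longrightarrow> raag_step E (x @ u @ y) (x @ v @ y)"
proof (induction rule: raag_step.induct)
  case (cancel u z b v)
  show ?case using raag_step.cancel[of E "x @ u" z b "v @ y"] by simp
next
  case (comm z w u b c v)
  then show ?case using raag_step.comm[of E z w "x @ u" b c "v @ y"] by simp
qed

lemma raag_eq_context: "raag_eq E u v \<Longrightarrow> raag_eq E (x @ u @ y) (x @ v @ y)"
proof (induction rule: raag_eq_induct)
  case (step u v)
  then show ?case
    unfolding raag_eq_def by (intro r_into_equivclp raag_step_context)
qed (auto intro: raag_eq_sym raag_eq_trans)

lemma raag_eq_append:
  assumes "raag_eq E u u'" "raag_eq E v v'"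
  shows "raag_eq E (u @ v) (u' @ v')"
  using raag_eq_context[OF assms(1), of "[]" v] raag_eq_context[OF assms(2), of u' "[]"]
  by (auto intro: raag_eq_trans)

lemma raag_eq_cancel_letter: "raag_eq E [(x, b), (x, \<not> b)] []"
  unfolding raag_eq_def using raag_step.cancel[of E "[]" x b "[]"]
  by (auto intro: r_into_equivclp)

lemma raag_eq_swap: "E x y \<Longrightarrow> raag_eq E ([(x, b)] @ [(y, c)]) ([(y, c)] @ [(x, b)])"
  unfolding raag_eq_def using raag_step.comm[of E x y "[]" b c "[]"]
  by (auto intro: r_into_equivclp)

lemma raag_eq_winv_right [simp]: "raag_eq E (w @ winv w) []"
proof (induction w)
  case (Cons x w)
  have "raag_eq E ([x] @ (w @ winv w) @ winv [x]) ([x] @ [] @ winv [x])"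
    by (rule raag_eq_context[OF Cons.IH])
  also have "raag_eq E ([x] @ [] @ winv [x]) []"
    using raag_eq_cancel_letter[of E "fst x" "snd x"] by (simp add: winv_Cons)
  finally show ?case by (simp add: winv_Cons)
qed simp

lemma raag_eq_winv_left [simp]: "raag_eq E (winv w @ w) []"
  using raag_eq_winv_right[of E "winv w"] by simp

lemma raag_eq_drop:
  "raag_eq E u [] \<Longrightarrow> raag_eq E (x @ u @ y) (x @ y)"
  using raag_eq_context[of E u "[]" x y] by simp

lemma raag_eq_winv_unique:
  assumes "raag_eq E (u @ v) []"
  shows "raag_eq E v (winv u)"
proof -
  have "raag_eq E (winv u @ u @ v) (winv u)"
    using raag_eq_context[OF assms, of "winv u" "[]"] by simp
  moreover have "raag_eq E ((winv u @ u) @ v) v"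
    using raag_eq_drop[OF raag_eq_winv_left, of E "[]" u v] by simp
  ultimately show ?thesis by (auto intro: raag_eq_sym raag_eq_trans)
qed

text \<open>\<open>v @ winv u\<close> and \<open>u @ winv u\<close> are equal in the group, so
  \<open>winv u\<close> is a right inverse of \<open>v\<close>, and right inverses are
  unique.\<close>

lemma raag_eq_winv:
  assumes "raag_eq E u v"
  shows "raag_eq E (winv u) (winv v)"
proof -
  have "raag_eq E (v @ winv u) (u @ winv u)"
    by (intro raag_eq_append raag_eq_refl raag_eq_sym[OF assms])
  also have "raag_eq E (u @ winv u) []" by simp
  finally show ?thesis by (rule raag_eq_winv_unique)
qed

text \<open>Moving a letter across an equation; the shape in which the relation
  \<open>x y = y x\<close> has to be rewritten when one of the letters is inverted.\<close>

lemma raag_eq_move: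
  assumes "raag_eq E (a @ b) (c @ d)"
  shows "raag_eq E (winv c @ a) (d @ winv b)"
proof -
  have "raag_eq E (winv c @ a) ((winv c @ a) @ (b @ winv b))"
    using raag_eq_append[OF raag_eq_refl raag_eq_sym[OF raag_eq_winv_right], of E "winv c @ a" b]
    by simp
  also have "(winv c @ a) @ (b @ winv b) = winv c @ (a @ b) @ winv b" by simp
  also have "raag_eq E \<dots> (winv c @ (c @ d) @ winv b)"
    by (rule raag_eq_context[OF assms])
  also have "\<dots> = [] @ (winv c @ c) @ d @ winv b" by simp
  also have "raag_eq E \<dots> ([] @ d @ winv b)"
    by (rule raag_eq_drop) simp
  finally show ?thesis by simp
qed

section \<open>Commuting words and conjugation\<close>

definition commute :: "('a \<Rightarrow> 'a \<Rightarrow> bool) \<Rightarrow> ('a \<times> bool) list \<Rightarrow> ('a \<times> bool) list \<Rightarrow> bool" where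
  "commute E u v \<longleftrightarrow> raag_eq E (u @ v) (v @ u)"

lemma commute_sym: "commute E u v \<Longrightarrow> commute E v u"
  unfolding commute_def by (rule raag_eq_sym)

lemma commute_Nil [simp]: "commute E u []" "commute E [] u"
  by (simp_all add: commute_def)

lemma commute_edge: "E x y \<Longrightarrow> commute E [(x, b)] [(y, c)]"
  unfolding commute_def by (rule raag_eq_swap)

lemma commute_append:
  assumes "commute E u v" "commute E u w"
  shows "commute E u (v @ w)"
proof -
  have "raag_eq E ((u @ v) @ w) ((v @ u) @ w)"
    using assms(1) unfolding commute_def by (rule raag_eq_append) simp
  also have "(v @ u) @ w = v @ (u @ w)" by simp
  also have "raag_eq E \<dots> (v @ (w @ u))"
    using assms(2) unfolding commute_def by (rule raag_eq_append[OF raag_eq_refl])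
  finally show ?thesis by (simp add: commute_def)
qed

lemma commute_winv: "commute E u v \<Longrightarrow> commute E u (winv v)"
  unfolding commute_def by (rule raag_eq_sym[OF raag_eq_move])

lemma commute_word:
  assumes "\<And>v c. (v, c) \<in> set w \<Longrightarrow> commute E u [(v, c)]"
  shows "commute E u w"
  using assms
proof (induction w)
  case (Cons x w)
  then have "commute E u ([x] @ w)"
    by (intro commute_append) (auto, metis prod.exhaust)
  then show ?case by simp
qed simp

lemma commute_conj:
  assumes "commute E u v"
  shows "commute E (c @ u @ winv c) (c @ v @ winv c)"
proof -
  have reduce: "raag_eq E ((c @ x @ winv c) @ (c @ y @ winv c)) (c @ (x @ y) @ winv c)" for x y
    using raag_eq_drop[OF raag_eq_winv_left[of E c], of "c @ x" "y @ winv c"] by simp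
  have "raag_eq E (c @ (u @ v) @ winv c) (c @ (v @ u) @ winv c)"
    using assms by (intro raag_eq_context) (simp add: commute_def)
  then show ?thesis
    unfolding commute_def using reduce by (blast intro: raag_eq_trans raag_eq_sym)
qed

lemma raag_eq_conj_commute:
  assumes "commute E c u"
  shows "raag_eq E (c @ u @ winv c) u"
proof -
  have "raag_eq E ((c @ u) @ winv c) ((u @ c) @ winv c)"
    using assms unfolding commute_def by (rule raag_eq_append) simp
  also have "raag_eq E ((u @ c) @ winv c) u"
    using raag_eq_drop[OF raag_eq_winv_right[of E c], of u "[]"] by simp
  finally show ?thesis by simp
qed


section \<open>The group and embeddings of finite index\<close>

definition raag_class :: "'a set \<Rightarrow> ('a \<Rightarrow> 'a \<Rightarrow> bool) \<Rightarrow> ('a \<times> bool) list \<Rightarrow> ('a \<times> bool) list set" where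
  "raag_class V E w = raag_rel V E `` {w}"

lemma raag_class_eq: "w \<in> raag_words V \<Longrightarrow> raag_class V E w = {w' \<in> raag_words V. raag_eq E w w'}"
  by (auto simp: raag_class_def raag_rel_def raag_eq_def)

lemma raag_class_eq_iff:
  assumes "u \<in> raag_words V" "v \<in> raag_words V"
  shows "raag_class V E u = raag_class V E v \<longleftrightarrow> raag_eq E u v"
  using assms by (auto simp: raag_class_eq intro: raag_eq_sym raag_eq_trans)

lemma carrier_RAAG: "carrier (RAAG V E) = raag_class V E ` raag_words V"
  by (auto simp: RAAG_def quotient_def raag_class_def)

lemma one_RAAG: "\<one>\<^bsub>RAAG V E\<^esub> = raag_class V E []"
  by (simp add: RAAG_def raag_class_def)

text \<open>The product of two classes is defined as a union of classes; these all coincide because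
  \<open>raag_eq\<close> is a congruence for concatenation.\<close>

lemma mult_RAAG:
  assumes "u \<in> raag_words V" "v \<in> raag_words V"
  shows "raag_class V E u \<otimes>\<^bsub>RAAG V E\<^esub> raag_class V E v = raag_class V E (u @ v)"
proof -
  have "raag_class V E u \<otimes>\<^bsub>RAAG V E\<^esub> raag_class V E v =
      (\<Union>w \<in> {a @ b |a b. a \<in> raag_class V E u \<and> b \<in> raag_class V E v}. raag_class V E w)"
    by (auto simp: RAAG_def raag_class_def)
  also have "\<dots> = raag_class V E (u @ v)"
  proof -
    have "raag_class V E (a @ b) = raag_class V E (u @ v)"
      if "a \<in> raag_class V E u" "b \<in> raag_class V E v" for a b
      using that assms by (subst raag_class_eq_iff)
        (auto simp: raag_class_eq intro: raag_eq_append raag_eq_sym)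
    moreover have "u \<in> raag_class V E u" "v \<in> raag_class V E v"
      using assms by (auto simp: raag_class_eq)
    ultimately show ?thesis by blast
  qed
  finally show ?thesis .
qed

lemma group_RAAG: "group (RAAG V E)"
proof (rule groupI)
  fix x assume "x \<in> carrier (RAAG V E)"
  then obtain w where "w \<in> raag_words V" "x = raag_class V E w"
    by (auto simp: carrier_RAAG)
  then show "\<exists>y\<in>carrier (RAAG V E). y \<otimes>\<^bsub>RAAG V E\<^esub> x = \<one>\<^bsub>RAAG V E\<^esub>"
    by (intro bexI[of _ "raag_class V E (winv w)"])
      (auto simp: carrier_RAAG mult_RAAG one_RAAG raag_class_eq_iff)
qed (auto simp: carrier_RAAG mult_RAAG one_RAAG)

text \<open>\<open>H\<close> is isomorphic to a subgroup of finite index in \<open>G\<close>. Witnessing the index by a finite set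
  of coset representatives makes transitivity immediate.\<close>

definition fi_embeds :: "('a, 'c) monoid_scheme \<Rightarrow> ('b, 'd) monoid_scheme \<Rightarrow> bool" where
  "fi_embeds G H \<longleftrightarrow> (\<exists>h R. h \<in> hom H G \<and> inj_on h (carrier H) \<and> finite R \<and> R \<subseteq> carrier G \<and>
     (\<forall>g\<in>carrier G. \<exists>x\<in>carrier H. \<exists>r\<in>R. g = h x \<otimes>\<^bsub>G\<^esub> r))"

lemma fi_embeds_trans:
  assumes "group G" "fi_embeds G H" "fi_embeds H K"
  shows "fi_embeds G K"
proof -
  interpret G: group G by fact
  obtain h R where h: "h \<in> hom H G" "inj_on h (carrier H)" "finite R" "R \<subseteq> carrier G"
    and hR: "\<forall>g\<in>carrier G. \<exists>x\<in>carrier H. \<exists>r\<in>R. g = h x \<otimes>\<^bsub>G\<^esub> r"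
    using assms(2) unfolding fi_embeds_def by blast
  obtain h' R' where h': "h' \<in> hom K H" "inj_on h' (carrier K)" "finite R'" "R' \<subseteq> carrier H"
    and hR': "\<forall>g\<in>carrier H. \<exists>x\<in>carrier K. \<exists>r\<in>R'. g = h' x \<otimes>\<^bsub>H\<^esub> r"
    using assms(3) unfolding fi_embeds_def by blast
  \<comment> \<open>If \<open>g\<close> is \<open>h x\<close> times \<open>r\<close> and
    \<open>x\<close> is \<open>h' y\<close> times \<open>s\<close>, then \<open>g\<close> is
    \<open>h (h' y)\<close> times \<open>h s\<close> times \<open>r\<close>; the products of
    \<open>h s\<close> and \<open>r\<close> therefore represent all cosets.\<close>
  define Q where "Q = (\<lambda>(s, r). h s \<otimes>\<^bsub>G\<^esub> r) ` (R' \<times> R)"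
  have "h \<circ> h' \<in> hom K G"
    using h(1) h'(1) by (auto simp: hom_def)
  moreover have "inj_on (h \<circ> h') (carrier K)"
    using h(2) h'(1,2) by (intro comp_inj_on) (auto simp: hom_def intro: inj_on_subset)
  moreover have "finite Q" "Q \<subseteq> carrier G"
    using h h' by (auto simp: Q_def hom_def subset_iff)
  moreover have "\<exists>x\<in>carrier K. \<exists>r\<in>Q. g = (h \<circ> h') x \<otimes>\<^bsub>G\<^esub> r" if g: "g \<in> carrier G" for g
  proof -
    obtain x r where x: "x \<in> carrier H" "r \<in> R" "g = h x \<otimes>\<^bsub>G\<^esub> r"
      using hR g by blast
    obtain y s where y: "y \<in> carrier K" "s \<in> R'" "x = h' y \<otimes>\<^bsub>H\<^esub> s"
      using hR' x(1) by blast
    have mem: "h' y \<in> carrier H" "s \<in> carrier H" "r \<in> carrier G"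
      using x y h h' by (auto simp: hom_def)
    then have "h (h' y) \<in> carrier G" "h s \<in> carrier G"
      using h(1) by (auto simp: hom_def)
    then have "g = h (h' y) \<otimes>\<^bsub>G\<^esub> (h s \<otimes>\<^bsub>G\<^esub> r)"
      using x(3) y(3) hom_mult[OF h(1) mem(1,2)] mem(3) by (simp add: G.m_assoc)
    then show ?thesis using x y by (auto simp: Q_def)
  qed
  ultimately show ?thesis unfolding fi_embeds_def by blast
qed

text \<open>The image of an embedding is a subgroup isomorphic to \<open>K\<close>, and each of its
  right cosets is that of one of the finitely many representatives. The two images are compared
  through \<open>K\<close>.\<close>

lemma fi_embeds_common_imp_commensurable:
  fixes G :: "('a, 'c) monoid_scheme" and H :: "('b, 'd) monoid_scheme"
    and K :: "('e, 'f) monoid_scheme"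
  assumes "group G" "group H" "group K" "fi_embeds G K" "fi_embeds H K"
  shows "commensurable G H"
proof -
  have image: "\<exists>h. subgroup (h ` carrier K) L \<and> finite (rcosets\<^bsub>L\<^esub> (h ` carrier K)) \<and>
      h \<in> iso K (L\<lparr>carrier := h ` carrier K\<rparr>)"
    if L: "group L" "fi_embeds L K" for L :: "('x, 'y) monoid_scheme"
  proof -
    interpret L: group L by fact
    obtain h R where h: "h \<in> hom K L" "inj_on h (carrier K)" "finite R" "R \<subseteq> carrier L"
      and hR: "\<forall>g\<in>carrier L. \<exists>x\<in>carrier K. \<exists>r\<in>R. g = h x \<otimes>\<^bsub>L\<^esub> r"
      using L(2) unfolding fi_embeds_def by blast
    interpret gh: group_hom K L h
      using assms(3) L(1) h(1) by (simp add: group_hom_def group_hom_axioms_def)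
    have sub: "subgroup (h ` carrier K) L"
      by (rule gh.img_is_subgroup)
    have "rcosets\<^bsub>L\<^esub> (h ` carrier K) \<subseteq> (\<lambda>r. h ` carrier K #>\<^bsub>L\<^esub> r) ` R"
    proof
      fix C assume "C \<in> rcosets\<^bsub>L\<^esub> (h ` carrier K)"
      then obtain g where g: "g \<in> carrier L" "C = h ` carrier K #>\<^bsub>L\<^esub> g"
        by (auto simp: RCOSETS_def)
      obtain x r where x: "x \<in> carrier K" "r \<in> R" "g = h x \<otimes>\<^bsub>L\<^esub> r"
        using hR g(1) by blast
      have "h ` carrier K #>\<^bsub>L\<^esub> g = (h ` carrier K #>\<^bsub>L\<^esub> h x) #>\<^bsub>L\<^esub> r"
        using x h(4) subgroup.subset[OF sub] by (subst L.coset_mult_assoc) auto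
      also have "h ` carrier K #>\<^bsub>L\<^esub> h x = h ` carrier K"
        using x(1) sub by (intro L.coset_join2) auto
      finally show "C \<in> (\<lambda>r. h ` carrier K #>\<^bsub>L\<^esub> r) ` R" using g(2) x(2) by auto
    qed
    then have "finite (rcosets\<^bsub>L\<^esub> (h ` carrier K))"
      using h(3) finite_surj by blast
    moreover have "h \<in> iso K (L\<lparr>carrier := h ` carrier K\<rparr>)"
      using h(1,2) by (auto simp: iso_def hom_def bij_betw_def)
    ultimately show ?thesis using sub by blast
  qed
  obtain f where f: "subgroup (f ` carrier K) G" "finite (rcosets\<^bsub>G\<^esub> (f ` carrier K))"
    "f \<in> iso K (G\<lparr>carrier := f ` carrier K\<rparr>)"
    using image[OF assms(1,4)] by blast
  obtain g where g: "subgroup (g ` carrier K) H" "finite (rcosets\<^bsub>H\<^esub> (g ` carrier K))"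
    "g \<in> iso K (H\<lparr>carrier := g ` carrier K\<rparr>)"
    using image[OF assms(2,5)] by blast
  have "G\<lparr>carrier := f ` carrier K\<rparr> \<cong> K"
    using f(3) group.iso_sym[OF assms(3)] unfolding is_iso_def by blast
  moreover have "K \<cong> H\<lparr>carrier := g ` carrier K\<rparr>"
    using g(3) unfolding is_iso_def by blast
  ultimately have "G\<lparr>carrier := f ` carrier K\<rparr> \<cong> H\<lparr>carrier := g ` carrier K\<rparr>"
    by (rule iso_trans)
  then show ?thesis
    unfolding commensurable_def using f(1,2) g(1,2) by blast
qed

section \<open>Reidemeister--Schreier rewriting\<close>

text \<open>A transducer reads a word of the first group letter by letter and outputs a word of the second;
  \<open>nx v\<close> is the permutation of the states effected by the letter \<open>v\<close> and \<open>pv v\<close> its inverse.\<close>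

locale raag_transducer =
  fixes E :: "'v \<Rightarrow> 'v \<Rightarrow> bool" and E' :: "'w \<Rightarrow> 'w \<Rightarrow> bool" and S :: "'s set"
    and nx pv :: "'v \<Rightarrow> 's \<Rightarrow> 's" and t :: "'s \<Rightarrow> 'v \<Rightarrow> ('w \<times> bool) list"
  assumes nx_in: "s \<in> S \<Longrightarrow> nx v s \<in> S" and pv_in: "s \<in> S \<Longrightarrow> pv v s \<in> S"
    and pv_nx: "s \<in> S \<Longrightarrow> pv v (nx v s) = s" and nx_pv: "s \<in> S \<Longrightarrow> nx v (pv v s) = s"
    and nx_comm: "E x y \<Longrightarrow> s \<in> S \<Longrightarrow> nx x (nx y s) = nx y (nx x s)"
    and t_comm: "E x y \<Longrightarrow> s \<in> S \<Longrightarrow> raag_eq E' (t s x @ t (nx x s) y) (t s y @ t (nx y s) x)"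
begin

fun run :: "'s \<Rightarrow> ('v \<times> bool) list \<Rightarrow> 's" where
  "run s [] = s"
| "run s ((v, b) # w) = run (if b then nx v s else pv v s) w"

text \<open>Reading the inverse of \<open>v\<close> in state \<open>s\<close> runs backwards along
  the transition from \<open>pv v s\<close> to \<open>s\<close>, so it outputs the inverse of what
  \<open>v\<close> outputs there.\<close>

fun out :: "'s \<Rightarrow> ('v \<times> bool) list \<Rightarrow> ('w \<times> bool) list" where
  "out s [] = []"
| "out s ((v, b) # w) =
    (if b then t s v @ out (nx v s) w else winv (t (pv v s) v) @ out (pv v s) w)"

lemma run_append [simp]: "run s (u @ w) = run (run s u) w"
  by (induction s u rule: run.induct) auto

lemma out_append [simp]: "out s (u @ w) = out s u @ out (run s u) w"
  by (induction s u rule: out.induct) auto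

lemma run_in: "s \<in> S \<Longrightarrow> run s w \<in> S"
  by (induction s w rule: run.induct) (auto simp: nx_in pv_in)

lemma nx_pv_comm:
  assumes "E x y" "s \<in> S"
  shows "nx x (pv y s) = pv y (nx x s)" and "nx y (pv x s) = pv x (nx y s)"
    and "pv x (pv y s) = pv y (pv x s)"
proof -
  have 1: "nx x (pv y s) = pv y (nx x s)" if "s \<in> S" for s
    using nx_comm[OF assms(1) pv_in[OF that, of y]] that
    by (metis nx_pv pv_nx nx_in pv_in)
  show "nx x (pv y s) = pv y (nx x s)" by (rule 1[OF assms(2)])
  show "nx y (pv x s) = pv x (nx y s)"
    using nx_comm[OF assms(1) pv_in[OF assms(2), of x]] assms(2)
    by (metis nx_pv pv_nx nx_in pv_in)
  show "pv x (pv y s) = pv y (pv x s)"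
    using 1[of "pv x s"] assms(2) by (metis nx_pv pv_nx nx_in pv_in)
qed


lemma run_step:
  assumes "raag_step E u w" "s \<in> S"
  shows "run s u = run s w"
  using assms
proof (induction rule: raag_step.induct)
  case (cancel u x b v)
  then show ?case using run_in[of s u] by (auto simp: pv_nx nx_pv)
next
  case (comm x y u b c v)
  then show ?case using run_in[of s u] nx_pv_comm[of x y "run s u"] nx_comm[of x y "run s u"]
    by auto
qed

text \<open>\<open>t_comm\<close> treats positive letters only. With inverted letters the same
  square of states is entered at another corner: \<open>t_comm\<close> is applied at the corner
  where both letters are read positively, and outputs are moved across the equation.\<close>

lemma out_swap:
  assumes "E x y" "s \<in> S"
  shows "raag_eq E' (out s [(x, b), (y, c)]) (out s [(y, c), (x, b)])"
proof -
  note comm = nx_pv_comm[OF assms] nx_pv[OF assms(2)]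
  consider "b" "c" | "b" "\<not> c" | "\<not> b" "c" | "\<not> b" "\<not> c" by blast
  then show ?thesis
  proof cases
    case 1
    then show ?thesis using t_comm[OF assms] by simp
  next
    case 2
    have "raag_eq E' (t (pv y s) x @ t (nx x (pv y s)) y) (t (pv y s) y @ t s x)"
      using t_comm[OF assms(1) pv_in[OF assms(2)], of y] comm by simp
    from raag_eq_sym[OF raag_eq_move[OF this]] show ?thesis using 2 comm by simp
  next
    case 3
    have "raag_eq E' (t (pv x s) y @ t (nx y (pv x s)) x) (t (pv x s) x @ t s y)"
      using t_comm[OF assms(1) pv_in[OF assms(2)], of x] comm by (simp add: raag_eq_sym)
    from raag_eq_move[OF this] show ?thesis using 3 comm by simp
  next
    case 4
    \<comment> \<open>The corner opposite to \<open>s\<close>: reading both letters positively from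
      \<open>s'\<close> leads back to \<open>s\<close>, so the whole relation is inverted.\<close>
    define s' where "s' = pv y (pv x s)"
    have "nx x s' = pv y s" "nx y s' = pv x s" "s' \<in> S"
      unfolding s'_def using comm assms(2) by (metis nx_pv pv_in)+
    then have "raag_eq E' (t s' y @ t (pv x s) x) (t s' x @ t (pv y s) y)"
      using t_comm[OF assms(1), of s'] by (simp add: raag_eq_sym)
    from raag_eq_winv[OF this] show ?thesis using 4 comm by (simp add: s'_def)
  qed
qed

lemma out_step:
  assumes "raag_step E u w" "s \<in> S"
  shows "raag_eq E' (out s u) (out s w)"
  using assms
proof (induction rule: raag_step.induct)
  case (cancel u x b v)
  define s' where "s' = run s u"
  have s': "s' \<in> S" using cancel run_in by (simp add: s'_def)
  have "raag_eq E' (out s' [(x, b), (x, \<not> b)]) []"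
    using s' by (cases b) (auto simp: pv_nx)
  moreover have "run s' [(x, b), (x, \<not> b)] = s'"
    using s' by (cases b) (auto simp: pv_nx nx_pv)
  ultimately show ?case
    unfolding out_append run_append s'_def[symmetric] by (metis raag_eq_drop)
next
  case (comm x y u b c v)
  define s' where "s' = run s u"
  have s': "s' \<in> S" using comm run_in by (simp add: s'_def)
  have "run s' [(x, b), (y, c)] = run s' [(y, c), (x, b)]"
    using run_step[of "[(x, b), (y, c)]" "[(y, c), (x, b)]", OF _ s']
      raag_step.comm[of E x y "[]" b c "[]"] comm(1) by simp
  then show ?case
    unfolding out_append run_append s'_def[symmetric]
    using raag_eq_context[OF out_swap[OF comm(1) s', of b c]] by metis
qed

lemma out_run_eq:
  assumes "raag_eq E u w"
  shows "s \<in> S \<longrightarrow> run s u = run s w \<and> raag_eq E' (out s u) (out s w)"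
  using assms
  by (induction rule: raag_eq_induct)
    (auto simp: run_step out_step intro: raag_eq_sym raag_eq_trans)

lemma run_eq: "raag_eq E u w \<Longrightarrow> s \<in> S \<Longrightarrow> run s u = run s w"
  and out_eq: "raag_eq E u w \<Longrightarrow> s \<in> S \<Longrightarrow> raag_eq E' (out s u) (out s w)"
  using out_run_eq by blast+

lemma run_winv: "s \<in> S \<Longrightarrow> run (run s w) (winv w) = s"
  using run_eq[OF raag_eq_winv_right, of s w] by simp

lemma out_winv: "s \<in> S \<Longrightarrow> raag_eq E' (out (run s w) (winv w)) (winv (out s w))"
  using out_eq[OF raag_eq_winv_right, of s w] by (auto intro: raag_eq_winv_unique)

end

section \<open>Substitutions, and covers as subgroups of finite index\<close>

definition subst :: "('w \<Rightarrow> ('v \<times> bool) list) \<Rightarrow> ('w \<times> bool) list \<Rightarrow> ('v \<times> bool) list" where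
  "subst f w = concat (map (\<lambda>(v, b). if b then f v else winv (f v)) w)"

lemma subst_simps [simp]:
  "subst f [] = []"
  "subst f ((v, b) # w) = (if b then f v else winv (f v)) @ subst f w"
  "subst f (u @ w) = subst f u @ subst f w"
  by (simp_all add: subst_def)

lemma subst_winv [simp]: "subst f (winv w) = winv (subst f w)"
  by (induction w) (auto simp: winv_Cons)

lemma subst_words:
  assumes "\<And>v. v \<in> V' \<Longrightarrow> f v \<in> raag_words V" "w \<in> raag_words V'"
  shows "subst f w \<in> raag_words V"
  using assms(2) by (induction w) (auto simp: assms(1))

text \<open>A homomorphism is a transducer with a single state, whose output respects the
  relations.\<close>

lemma subst_eq:
  assumes "\<And>x y. E' x y \<Longrightarrow> commute E (f x) (f y)" "raag_eq E' u w"
  shows "raag_eq E (subst f u) (subst f w)"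
proof -
  interpret raag_transducer E' E "{0::nat}" "\<lambda>_ s. s" "\<lambda>_ s. s" "\<lambda>_. f"
    by unfold_locales (use assms(1) in \<open>auto simp: commute_def\<close>)
  have "out 0 w = subst f w" for w
    by (induction w) auto
  then show ?thesis using out_eq[OF assms(2), of 0] by simp
qed

text \<open>The new group is to be the stabilizer of \<open>s\<^sub>0\<close>: \<open>al\<close>
  gives the old word for each new generator, \<open>tr\<close> plays the role of a Schreier
  transversal, and \<open>al_t\<close> says that \<open>t s v\<close> spells the Schreier generator
  of \<open>s\<close> and \<open>v\<close>. By \<open>out_al\<close> and \<open>al_t\<close>,
  rewriting and substitution become mutually inverse.\<close>

locale raag_cover = raag_transducer E E' S nx pv t
  for E :: "'v \<Rightarrow> 'v \<Rightarrow> bool" and E' :: "'w \<Rightarrow> 'w \<Rightarrow> bool" and S :: "'s set"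
    and nx pv :: "'v \<Rightarrow> 's \<Rightarrow> 's" and t :: "'s \<Rightarrow> 'v \<Rightarrow> ('w \<times> bool) list" +
  fixes V :: "'v set" and V' :: "'w set" and s\<^sub>0 :: 's
    and al :: "'w \<Rightarrow> ('v \<times> bool) list" and tr :: "'s \<Rightarrow> ('v \<times> bool) list"
  assumes finite_S: "finite S" and s\<^sub>0: "s\<^sub>0 \<in> S"
    and t_words: "v \<in> V \<Longrightarrow> s \<in> S \<Longrightarrow> t s v \<in> raag_words V'"
    and al_words: "v' \<in> V' \<Longrightarrow> al v' \<in> raag_words V"
    and al_comm: "E' x' y' \<Longrightarrow> commute E (al x') (al y')"
    and run_al: "v' \<in> V' \<Longrightarrow> run s\<^sub>0 (al v') = s\<^sub>0"
    and out_al: "v' \<in> V' \<Longrightarrow> raag_eq E' (out s\<^sub>0 (al v')) [(v', True)]"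
    and tr_s\<^sub>0: "tr s\<^sub>0 = []"
    and al_t: "v \<in> V \<Longrightarrow> s \<in> S \<Longrightarrow>
      raag_eq E (subst al (t s v)) (tr s @ [(v, True)] @ winv (tr (nx v s)))"
begin

text \<open>Rewriting is a left inverse of substitution; this makes the embedding injective.\<close>

lemma run_out_subst:
  assumes "w \<in> raag_words V'"
  shows "run s\<^sub>0 (subst al w) = s\<^sub>0 \<and> raag_eq E' (out s\<^sub>0 (subst al w)) w"
  using assms
proof (induction w)
  case (Cons x w)
  obtain v b where x: "x = (v, b)" by force
  with Cons have v: "v \<in> V'" and IH: "run s\<^sub>0 (subst al w) = s\<^sub>0" "raag_eq E' (out s\<^sub>0 (subst al w)) w"
    by auto
  let ?u = "if b then al v else winv (al v)"
  have "run s\<^sub>0 ?u = s\<^sub>0"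
    using run_al[OF v] run_winv[OF s\<^sub>0, of "al v"] by simp
  moreover have "raag_eq E' (out s\<^sub>0 ?u) [x]"
    using out_al[OF v] out_winv[OF s\<^sub>0, of "al v"] raag_eq_winv[OF out_al[OF v]]
    by (auto simp: x run_al[OF v] intro: raag_eq_trans)
  ultimately show ?case
    using raag_eq_append[of E' "out s\<^sub>0 ?u" "[x]", OF _ IH(2)] IH(1) by (simp add: x)
qed simp

lemma out_words: "w \<in> raag_words V \<Longrightarrow> s \<in> S \<Longrightarrow> out s w \<in> raag_words V'"
  by (induction s w rule: out.induct) (auto simp: t_words nx_in pv_in)

text \<open>Schreier generators of successive letters telescope: the transversal word closing one
  letter cancels against the one opening the next.\<close>

lemma subst_out:
  assumes "w \<in> raag_words V" "s \<in> S"
  shows "raag_eq E (subst al (out s w)) (tr s @ w @ winv (tr (run s w)))"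
  using assms
proof (induction s w rule: out.induct)
  case (2 s v b w)
  define s' where "s' = (if b then nx v s else pv v s)"
  have s': "s' \<in> S" using 2 by (simp add: s'_def nx_in pv_in)
  let ?u = "if b then t s v else winv (t (pv v s) v)"
  have v: "v \<in> V" "w \<in> raag_words V" using 2 by auto
  have "raag_eq E (subst al ?u) (tr s @ [(v, b)] @ winv (tr s'))"
  proof (cases b)
    case True
    then show ?thesis using al_t[OF v(1) 2(4)] by (simp add: s'_def)
  next
    case False
    then show ?thesis
      using raag_eq_winv[OF al_t[OF v(1) pv_in[OF 2(4), of v]]] 2(4)
      by (simp add: s'_def nx_pv winv_Cons)
  qed
  moreover have "raag_eq E (subst al (out s' w)) (tr s' @ w @ winv (tr (run s' w)))"
    using 2 v s' by (cases b) (auto simp: s'_def)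
  ultimately have "raag_eq E (subst al ?u @ subst al (out s' w))
      ((tr s @ [(v, b)] @ winv (tr s')) @ (tr s' @ w @ winv (tr (run s' w))))"
    by (rule raag_eq_append)
  also have "\<dots> = (tr s @ [(v, b)]) @ (winv (tr s') @ tr s') @ (w @ winv (tr (run s' w)))"
    by simp
  also have "raag_eq E \<dots> ((tr s @ [(v, b)]) @ (w @ winv (tr (run s' w))))"
    by (rule raag_eq_drop) simp
  finally show ?case by (simp add: s'_def split: if_splits)
qed (simp add: raag_eq_sym)

theorem fi_embeds_RAAG: "fi_embeds (RAAG V E) (RAAG V' E')"
proof -
  define h where "h C = raag_class V E (subst al (SOME w. w \<in> C))" for C
  have subst_in: "subst al w \<in> raag_words V" if "w \<in> raag_words V'" for w
    using al_words that by (rule subst_words)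
  have h: "h (raag_class V' E' w) = raag_class V E (subst al w)" if w: "w \<in> raag_words V'" for w
  proof -
    define u where "u = (SOME u. u \<in> raag_class V' E' w)"
    have "u \<in> raag_class V' E' w"
      unfolding u_def
      by (rule someI[of "\<lambda>u. u \<in> raag_class V' E' w" w]) (simp add: raag_class_eq w)
    then have u: "u \<in> raag_words V'" "raag_eq E' w u"
      using w by (auto simp: raag_class_eq)
    have "raag_eq E (subst al u) (subst al w)"
      by (rule subst_eq[OF al_comm raag_eq_sym[OF u(2)]])
    then show ?thesis
      unfolding h_def u_def[symmetric] using u w
      by (subst raag_class_eq_iff) (auto simp: subst_in)
  qed
  \<comment> \<open>One word is picked for each state reached from \<open>s\<^sub>0\<close>; as
    there are finitely many states, the image gets finite index.\<close>
  define rep where "rep s = (SOME w. w \<in> raag_words V \<and> run s\<^sub>0 w = s)" for s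
  define R where "R = (\<lambda>s. raag_class V E (rep s)) ` run s\<^sub>0 ` raag_words V"
  have rep: "rep (run s\<^sub>0 w) \<in> raag_words V" "run s\<^sub>0 (rep (run s\<^sub>0 w)) = run s\<^sub>0 w"
    if "w \<in> raag_words V" for w
    using someI[of "\<lambda>u. u \<in> raag_words V \<and> run s\<^sub>0 u = run s\<^sub>0 w" w] that by (auto simp: rep_def)
  have "h \<in> hom (RAAG V' E') (RAAG V E)"
    by (auto simp: hom_def carrier_RAAG mult_RAAG h subst_in)
  moreover have "inj_on h (carrier (RAAG V' E'))"
  proof (rule inj_onI)
    fix x y assume "x \<in> carrier (RAAG V' E')" "y \<in> carrier (RAAG V' E')" and eq: "h x = h y"
    then obtain u w where u: "u \<in> raag_words V'" "x = raag_class V' E' u"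
      and w: "w \<in> raag_words V'" "y = raag_class V' E' w" by (auto simp: carrier_RAAG)
    have "raag_eq E (subst al u) (subst al w)"
      using eq u w by (simp add: h raag_class_eq_iff subst_in)
    then have "raag_eq E' (out s\<^sub>0 (subst al u)) (out s\<^sub>0 (subst al w))"
      by (rule out_eq) (rule s\<^sub>0)
    then have "raag_eq E' u w"
      using run_out_subst u w by (meson raag_eq_sym raag_eq_trans)
    then show "x = y" using u w by (simp add: raag_class_eq_iff)
  qed
  moreover have "finite R"
    unfolding R_def using finite_S run_in[OF s\<^sub>0] by (auto intro: finite_subset)
  moreover have "R \<subseteq> carrier (RAAG V E)"
    using rep by (auto simp: R_def carrier_RAAG)
  moreover have "\<exists>x\<in>carrier (RAAG V' E'). \<exists>r\<in>R. g = h x \<otimes>\<^bsub>RAAG V E\<^esub> r"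
    if "g \<in> carrier (RAAG V E)" for g
  proof -
    obtain w where w: "w \<in> raag_words V" "g = raag_class V E w"
      using \<open>g \<in> _\<close> by (auto simp: carrier_RAAG)
    \<comment> \<open>\<open>c\<close> leads to the same state as \<open>w\<close>, so
      \<open>w @ winv c\<close> fixes \<open>s\<^sub>0\<close> and lies in the image by
      \<open>subst_out\<close>.\<close>
    define c where "c = rep (run s\<^sub>0 w)"
    have c: "c \<in> raag_words V" "run s\<^sub>0 c = run s\<^sub>0 w" using rep[OF w(1)] by (auto simp: c_def)
    define u where "u = out s\<^sub>0 (w @ winv c)"
    have u: "u \<in> raag_words V'" unfolding u_def using w c s\<^sub>0 by (intro out_words) auto
    have "run s\<^sub>0 (w @ winv c) = s\<^sub>0" using run_winv[OF s\<^sub>0, of c] c(2) by simp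
    then have "raag_eq E (subst al u) (w @ winv c)"
      unfolding u_def using subst_out[of "w @ winv c", OF _ s\<^sub>0] w c
      by (simp add: tr_s\<^sub>0)
    then have "raag_eq E (subst al u @ c) ((w @ winv c) @ c)"
      by (rule raag_eq_append) simp
    also have "raag_eq E \<dots> w" using raag_eq_drop[of E "winv c @ c" w "[]"] by simp
    finally have "g = h (raag_class V' E' u) \<otimes>\<^bsub>RAAG V E\<^esub> raag_class V E c"
      using u w c by (simp add: h mult_RAAG subst_in raag_class_eq_iff raag_eq_sym)
    then show ?thesis
      using u w(1) by (auto simp: carrier_RAAG R_def c_def)
  qed
  ultimately show ?thesis unfolding fi_embeds_def by blast
qed

end

text \<open>A graph isomorphism is a cover with one state. Edges may be reversed, since
  \<open>star_E\<close> lists each edge in one direction while \<open>tree4_adj\<close> is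
  symmetric.\<close>

lemma fi_embeds_RAAG_relabel:
  fixes V :: "'v set" and V' :: "'w set"
  assumes f: "\<And>v. v \<in> V \<Longrightarrow> f v \<in> V'" "\<And>v. v \<in> V \<Longrightarrow> g (f v) = v"
    and g: "\<And>v. v \<in> V' \<Longrightarrow> g v \<in> V" "\<And>v. v \<in> V' \<Longrightarrow> f (g v) = v"
    and E: "\<And>x y. E x y \<Longrightarrow> E' (f x) (f y) \<or> E' (f y) (f x)"
    and E': "\<And>x y. E' x y \<Longrightarrow> E (g x) (g y) \<or> E (g y) (g x)"
  shows "fi_embeds (RAAG V E) (RAAG V' E')"
proof -
  have comm: "commute F [(x, True)] [(y, True)]" if "F x y \<or> F y x" for F and x y :: 'x
    using that by (auto intro: commute_edge commute_sym[OF commute_edge])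
  interpret raag_transducer E E' "{0::nat}" "\<lambda>_ s. s" "\<lambda>_ s. s" "\<lambda>_ v. [(f v, True)]"
    using E comm[of E'] by unfold_locales (auto simp: commute_def)
  interpret raag_cover E E' "{0::nat}" "\<lambda>_ s. s" "\<lambda>_ s. s" "\<lambda>_ v. [(f v, True)]" V V' 0
    "\<lambda>v. [(g v, True)]" "\<lambda>_. []"
    using f g E' comm[of E] by unfold_locales auto
  show ?thesis by (rule fi_embeds_RAAG)
qed

section \<open>Trees of diameter four\<close>

text \<open>A hair vertex is a pivot without leaves, so such a tree is a set \<open>Y\<close> of neighbours of the
  center together with the number \<open>d y\<close> of leaves at each \<open>y \<in> Y\<close>. As relation steps are
  closed under symmetry, it suffices to list every edge in one direction.\<close>

datatype 'y star_vert = Ctr | Piv 'y | Lf 'y nat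

definition star_V :: "'y set \<Rightarrow> ('y \<Rightarrow> nat) \<Rightarrow> 'y star_vert set" where
  "star_V Y d = {Ctr} \<union> Piv ` Y \<union> {Lf y j |y j. y \<in> Y \<and> j < d y}"

definition star_E :: "'y set \<Rightarrow> ('y \<Rightarrow> nat) \<Rightarrow> 'y star_vert \<Rightarrow> 'y star_vert \<Rightarrow> bool" where
  "star_E Y d u v \<longleftrightarrow> (\<exists>y\<in>Y. u = Ctr \<and> v = Piv y) \<or> (\<exists>y\<in>Y. \<exists>j<d y. u = Piv y \<and> v = Lf y j)"

lemma star_V_simps [simp]:
  "Ctr \<in> star_V Y d" "Piv y \<in> star_V Y d \<longleftrightarrow> y \<in> Y" "Lf y j \<in> star_V Y d \<longleftrightarrow> y \<in> Y \<and> j < d y"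
  by (auto simp: star_V_def)

lemma star_E_cases:
  assumes "star_E Y d u v"
  obtains (center) y where "y \<in> Y" "u = Ctr" "v = Piv y"
    | (leaf) y j where "y \<in> Y" "j < d y" "u = Piv y" "v = Lf y j"
  using assms by (auto simp: star_E_def)

lemma star_E_Ctr: "y \<in> Y \<Longrightarrow> star_E Y d Ctr (Piv y)"
  and star_E_Lf: "y \<in> Y \<Longrightarrow> j < d y \<Longrightarrow> star_E Y d (Piv y) (Lf y j)"
  by (auto simp: star_E_def)

definition star_RAAG :: "'y set \<Rightarrow> ('y \<Rightarrow> nat) \<Rightarrow> ('y star_vert \<times> bool) list set monoid" where
  "star_RAAG Y d = RAAG (star_V Y d) (star_E Y d)"

lemma group_star_RAAG: "group (star_RAAG Y d)"
  by (simp add: star_RAAG_def group_RAAG)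

section \<open>Cyclic covers and powers of a generator\<close>

definition cyc_nx :: "nat \<Rightarrow> ('v \<Rightarrow> bool) \<Rightarrow> 'v \<Rightarrow> nat \<Rightarrow> nat" where
  "cyc_nx b \<phi> v s = (if \<phi> v then (if Suc s = b then 0 else Suc s) else s)"

definition cyc_pv :: "nat \<Rightarrow> ('v \<Rightarrow> bool) \<Rightarrow> 'v \<Rightarrow> nat \<Rightarrow> nat" where
  "cyc_pv b \<phi> v s = (if \<phi> v then (if s = 0 then b - 1 else s - 1) else s)"

text \<open>Every letter acts on the states as the identity or as one fixed cycle of length
  \<open>b\<close>, so these permutations commute and only the outputs remain to be
  compared.\<close>

lemma raag_transducer_cyclic:
  assumes "0 < b"
    and "\<And>x y s. E x y \<Longrightarrow> s < b \<Longrightarrow>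
      raag_eq E' (t s x @ t (cyc_nx b \<phi> x s) y) (t s y @ t (cyc_nx b \<phi> y s) x)"
  shows "raag_transducer E E' {..<b} (cyc_nx b \<phi>) (cyc_pv b \<phi>) t"
  using assms by unfold_locales (auto simp: cyc_nx_def cyc_pv_def)

definition pw :: "'v \<Rightarrow> nat \<Rightarrow> ('v \<times> bool) list" where
  "pw v n = replicate n (v, True)"

lemma pw_0 [simp]: "pw v 0 = []"
  and pw_Suc: "pw v (Suc n) = pw v n @ [(v, True)]"
  by (simp_all add: pw_def replicate_append_same)

lemma pw_in_words [simp]: "v \<in> V \<Longrightarrow> pw v n \<in> raag_words V"
  by (auto simp: pw_def raag_words_iff)

lemma set_pw: "set (pw v n) \<subseteq> {(v, True)}"
  by (auto simp: pw_def)

lemma commute_pw_edge: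
  "E v x \<Longrightarrow> commute E (pw v n) [(x, c)]" "E x v \<Longrightarrow> commute E [(x, c)] (pw v n)"
  "E x v \<Longrightarrow> commute E (pw v n) [(x, c)]" "E v x \<Longrightarrow> commute E [(x, c)] (pw v n)"
proof -
  have *: "commute E [(x, c)] (pw v n)" if "E v x \<or> E x v"
  proof (rule commute_word)
    fix z c' assume "(z, c') \<in> set (pw v n)"
    then show "commute E [(x, c)] [(z, c')]"
      using that set_pw[of v n] by (auto intro: commute_edge commute_sym[OF commute_edge])
  qed
  show "E v x \<Longrightarrow> commute E (pw v n) [(x, c)]" "E x v \<Longrightarrow> commute E [(x, c)] (pw v n)"
    "E x v \<Longrightarrow> commute E (pw v n) [(x, c)]" "E v x \<Longrightarrow> commute E [(x, c)] (pw v n)"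
    using * commute_sym by blast+
qed

subsection \<open>The cover unwrapping the center\<close>

text \<open>The kernel is generated by the \<open>b\<close>-th power of the center, the pivots, and
  the conjugates of the leaves by the powers of the center with exponent below \<open>b\<close>.
  Pivots commute with the center and are not multiplied; each leaf yields \<open>b\<close> leaves at
  the same pivot.\<close>

lemma fi_embeds_star_RAAG_center:
  assumes b: "0 < b"
  shows "fi_embeds (star_RAAG Y d) (star_RAAG Y (\<lambda>y. d y * b))"
proof -
  let ?E = "star_E Y d" and ?E' = "star_E Y (\<lambda>y. d y * b)"
  define \<phi> :: "'a star_vert \<Rightarrow> bool" where "\<phi> v \<longleftrightarrow> v = Ctr" for v
  \<comment> \<open>The state counts the center modulo \<open>b\<close>, and only the wrap-around
    outputs the new center. Leaf \<open>j\<close> read in state \<open>s\<close> becomes leaf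
    \<open>j * b + s\<close>.\<close>
  define t :: "nat \<Rightarrow> 'a star_vert \<Rightarrow> ('a star_vert \<times> bool) list" where
    "t s v = (case v of Ctr \<Rightarrow> if Suc s = b then [(Ctr, True)] else []
       | Piv y \<Rightarrow> [(Piv y, True)] | Lf y j \<Rightarrow> [(Lf y (j * b + s), True)])" for s v
  \<comment> \<open>Decoding leaf \<open>u\<close>: the old leaf is \<open>u div b\<close>, the
    conjugating exponent \<open>u mod b\<close>.\<close>
  define al :: "'a star_vert \<Rightarrow> ('a star_vert \<times> bool) list" where
    "al v = (case v of Ctr \<Rightarrow> pw Ctr b | Piv y \<Rightarrow> [(Piv y, True)]
       | Lf y u \<Rightarrow> pw Ctr (u mod b) @ [(Lf y (u div b), True)] @ winv (pw Ctr (u mod b)))" for v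
  have leaf_less: "j * b + s < d y * b" if "j < d y" "s < b" for j s y
  proof -
    have "j * b + s < Suc j * b" using that(2) by simp
    also have "\<dots> \<le> d y * b" using that(1) by (intro mult_right_mono) auto
    finally show ?thesis .
  qed
  interpret raag_transducer ?E ?E' "{..<b}" "cyc_nx b \<phi>" "cyc_pv b \<phi>" t
  proof (rule raag_transducer_cyclic[OF b])
    fix x y s assume "?E x y" and s: "s < b"
    then show "raag_eq ?E' (t s x @ t (cyc_nx b \<phi> x s) y) (t s y @ t (cyc_nx b \<phi> y s) x)"
    proof (cases rule: star_E_cases)
      case (center z)
      then show ?thesis
        using raag_eq_swap[of ?E' Ctr "Piv z" True True] 
        by (auto simp: t_def star_E_Ctr cyc_nx_def \<phi>_def)
    next
      case (leaf z j)
      then show ?thesis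
        using raag_eq_swap[of ?E' "Piv z" "Lf z (j * b + s)" True True] leaf_less[OF leaf(2) s]
        by (auto simp: t_def star_E_Lf cyc_nx_def \<phi>_def)
    qed
  qed
  have run_pw: "run 0 (pw Ctr s) = s" and out_pw: "out 0 (pw Ctr s) = []" if "s < b" for s
    using that by (induction s) (auto simp: pw_Suc cyc_nx_def \<phi>_def t_def)
  have unfold_b: "pw Ctr b = pw Ctr (b - 1) @ [(Ctr, True)]"
    using pw_Suc[of Ctr "b - 1"] b by simp
  have pw_b: "run 0 (pw Ctr b) = 0" "out 0 (pw Ctr b) = [(Ctr, True)]"
    unfolding unfold_b using run_pw[of "b - 1"] out_pw[of "b - 1"] b
    by (simp_all add: cyc_nx_def \<phi>_def t_def)
  have run_back: "run s (winv (pw Ctr s)) = 0" and out_back: "raag_eq ?E' (out s (winv (pw Ctr s))) []"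
    if "s < b" for s
    using run_winv[of 0 "pw Ctr s"] out_winv[of 0 "pw Ctr s"] b
    by (simp_all add: run_pw[OF that] out_pw[OF that])
  interpret raag_cover ?E ?E' "{..<b}" "cyc_nx b \<phi>" "cyc_pv b \<phi>" t "star_V Y d"
    "star_V Y (\<lambda>y. d y * b)" 0 al "pw Ctr"
  proof unfold_locales
    fix v s assume v: "v \<in> star_V Y d" "s \<in> {..<b}"
    then show "t s v \<in> raag_words (star_V Y (\<lambda>y. d y * b))"
      using leaf_less by (cases v) (auto simp: t_def)
    show "raag_eq ?E (subst al (t s v)) (pw Ctr s @ [(v, True)] @ winv (pw Ctr (cyc_nx b \<phi> v s)))"
    proof (cases v)
      case Ctr
      show ?thesis
      proof (cases "Suc s = b")
        case True
        then show ?thesis by (auto simp: Ctr t_def al_def cyc_nx_def \<phi>_def pw_Suc)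
      next
        case False
        have "raag_eq ?E [] (pw Ctr (Suc s) @ winv (pw Ctr (Suc s)))"
          by (rule raag_eq_sym) simp
        then show ?thesis using False by (simp add: Ctr t_def cyc_nx_def \<phi>_def pw_Suc)
      qed
    next
      case (Piv y)
      have "commute ?E (pw Ctr s) [(Piv y, True)]"
        using v(1) Piv by (intro commute_pw_edge) (simp add: star_E_Ctr)
      from raag_eq_sym[OF raag_eq_conj_commute[OF this]] show ?thesis
        by (simp add: Piv t_def al_def cyc_nx_def \<phi>_def)
    next
      case (Lf y j)
      then show ?thesis using v by (auto simp: t_def al_def cyc_nx_def \<phi>_def)
    qed
  next
    fix v assume v: "v \<in> star_V Y (\<lambda>y. d y * b)"
    then show "al v \<in> raag_words (star_V Y d)"
      by (cases v) (auto simp: al_def less_mult_imp_div_less)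
    have "run 0 (al v) = 0 \<and> raag_eq ?E' (out 0 (al v)) [(v, True)]"
    proof (cases v)
      case (Lf y u)
      have m: "u mod b < b" using b by simp
      show ?thesis
        using run_pw[OF m] out_pw[OF m] run_back[OF m] 
          raag_eq_append[OF raag_eq_refl out_back[OF m], of "[(Lf y u, True)]"]
        by (auto simp: Lf al_def cyc_nx_def \<phi>_def t_def)
    qed (auto simp: al_def pw_b cyc_nx_def \<phi>_def t_def)
    then show "run 0 (al v) = 0" "raag_eq ?E' (out 0 (al v)) [(v, True)]" by auto
  next
    fix x y assume "?E' x y"
    then show "commute ?E (al x) (al y)"
    proof (cases rule: star_E_cases)
      case (center z)
      then show ?thesis by (auto simp: al_def star_E_Ctr intro: commute_pw_edge)
    next
      case (leaf z u)
      have C: "commute ?E [(Piv z, True)] (pw Ctr n)" for n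
        using leaf by (intro commute_pw_edge) (simp add: star_E_Ctr)
      have L: "commute ?E [(Piv z, True)] [(Lf z (u div b), True)]"
        using leaf by (intro commute_edge star_E_Lf) (simp_all add: less_mult_imp_div_less)
      show ?thesis
        unfolding leaf al_def star_vert.case by (intro commute_append commute_winv C L)
    qed
  qed (use b in auto)
  show ?thesis unfolding star_RAAG_def by (rule fi_embeds_RAAG)
qed

subsection \<open>The cover unwrapping a set of pivots\<close>

text \<open>The pivots in \<open>A\<close> are sent to a generator of the cyclic group of order \<open>b\<close>, and the powers of
  \<open>a\<^sub>0 \<in> A\<close> form the transversal. The pivot \<open>(y, 0)\<close> of the cover stands for \<open>y\<^sup>b\<close> if \<open>y \<in> A\<close>; the new hair
  \<open>(y, s)\<close> stands for \<open>a\<^sub>0\<^sup>s y\<^sup>-\<^sup>s\<close>. For \<open>y \<notin> A\<close>, the pivot \<open>(y, s)\<close> is the conjugate of \<open>y\<close> by \<open>a\<^sub>0\<^sup>s\<close>.\<close>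

definition unwrap_pivots :: "'y set \<Rightarrow> 'y \<Rightarrow> nat \<Rightarrow> ('y \<times> nat) set" where
  "unwrap_pivots Y a\<^sub>0 b = {(y, s). y \<in> Y \<and> s < b \<and> (y = a\<^sub>0 \<longrightarrow> s = 0)}"

definition unwrap_degree :: "('y \<Rightarrow> nat) \<Rightarrow> 'y set \<Rightarrow> 'y \<times> nat \<Rightarrow> nat" where
  "unwrap_degree d A = (\<lambda>(y, s). if y \<in> A \<and> s \<noteq> 0 then 0 else d y)"

lemma fi_embeds_star_RAAG_unwrap:
  fixes Y A :: "'y set"
  assumes A: "A \<subseteq> Y" "a\<^sub>0 \<in> A" and b: "0 < b"
  shows "fi_embeds (star_RAAG Y d) (star_RAAG (unwrap_pivots Y a\<^sub>0 b) (unwrap_degree d A))"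
proof -
  define Y' d' where "Y' = unwrap_pivots Y a\<^sub>0 b" and "d' = unwrap_degree d A"
  let ?E = "star_E Y d" and ?E' = "star_E Y' d'"
  have Y': "(y, s) \<in> Y' \<longleftrightarrow> y \<in> Y \<and> s < b \<and> (y = a\<^sub>0 \<longrightarrow> s = 0)" for y s
    by (simp add: Y'_def unwrap_pivots_def)
  have d': "d' (y, s) = (if y \<in> A \<and> s \<noteq> 0 then 0 else d y)" for y s
    by (simp add: d'_def unwrap_degree_def)
  \<comment> \<open>\<open>hair y s\<close> spells
    \<open>a\<^sub>0\<^sup>s y\<^sup>-\<^sup>s\<close>. It is empty in the two cases where this
    element is visibly trivial; accordingly the cover has no pivot \<open>(a\<^sub>0, s)\<close>
    with positive \<open>s\<close>.\<close>
  define hair :: "'y \<Rightarrow> nat \<Rightarrow> (('y \<times> nat) star_vert \<times> bool) list" where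
    "hair y s = (if s = 0 \<or> y = a\<^sub>0 then [] else [(Piv (y, s), True)])" for y s
  define \<phi> :: "'y star_vert \<Rightarrow> bool" where "\<phi> v \<longleftrightarrow> v \<in> Piv ` A" for v
  \<comment> \<open>For \<open>y\<close> in \<open>A\<close> the Schreier generator
    \<open>tr s @ [(Piv y, True)] @ winv (tr (Suc s))\<close> is \<open>hair y s\<close> times the
    inverse of \<open>hair y (Suc s)\<close>; at the wrap-around it is \<open>hair y s\<close>
    followed by \<open>y\<^sup>b\<close>. A leaf at \<open>y\<close> commutes with \<open>y\<close>,
    so conjugating it by \<open>tr s\<close> or by \<open>hair y s\<close> is the same.\<close>
  define t :: "nat \<Rightarrow> 'y star_vert \<Rightarrow> (('y \<times> nat) star_vert \<times> bool) list" where
    "t s v = (case v of Ctr \<Rightarrow> [(Ctr, True)]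
       | Piv y \<Rightarrow> if y \<in> A
           then hair y s @ (if Suc s = b then [(Piv (y, 0), True)] else winv (hair y (Suc s)))
           else [(Piv (y, s), True)]
       | Lf y j \<Rightarrow> if y \<in> A then hair y s @ [(Lf (y, 0) j, True)] @ winv (hair y s)
           else [(Lf (y, s) j, True)])" for s v
  define tr where "tr s = pw (Piv a\<^sub>0) s" for s
  define al :: "('y \<times> nat) star_vert \<Rightarrow> ('y star_vert \<times> bool) list" where
    "al v = (case v of Ctr \<Rightarrow> [(Ctr, True)]
       | Piv z \<Rightarrow> (case z of (y, s) \<Rightarrow> if y \<in> A
           then if s = 0 then pw (Piv y) b else tr s @ winv (pw (Piv y) s)
           else tr s @ [(Piv y, True)] @ winv (tr s))
       | Lf z j \<Rightarrow> (case z of (y, s) \<Rightarrow> if y \<in> A then [(Lf y j, True)]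
           else tr s @ [(Lf y j, True)] @ winv (tr s)))" for v
  have a\<^sub>0: "a\<^sub>0 \<in> Y" using A by auto
  have hair_words: "hair y s \<in> raag_words (star_V Y' d')" if "y \<in> Y" "s < b" for y s
    using that by (simp add: hair_def Y')
  have hair_comm: "commute ?E' [(Ctr, True)] (hair y s)" if "y \<in> Y" "s < b" for y s
    using that by (auto simp: hair_def Y' intro!: commute_edge star_E_Ctr)
  have nx_A: "cyc_nx b \<phi> (Piv y) s = (if Suc s = b then 0 else Suc s)" if "y \<in> A" for y s
    using that by (simp add: cyc_nx_def \<phi>_def)
  have nx_B: "cyc_nx b \<phi> (Piv y) s = s" if "y \<notin> A" for y s
    using that by (auto simp: cyc_nx_def \<phi>_def)
  have nx_other: "cyc_nx b \<phi> Ctr s = s" "cyc_nx b \<phi> (Lf y j) s = s" for y j s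
    by (auto simp: cyc_nx_def \<phi>_def)
  have hair_0: "hair y 0 = []" "hair a\<^sub>0 s = []" for y s by (simp_all add: hair_def)
  have t_simps: "t s Ctr = [(Ctr, True)]"
    "t s (Piv y) = (if y \<in> A
       then hair y s @ (if Suc s = b then [(Piv (y, 0), True)] else winv (hair y (Suc s)))
       else [(Piv (y, s), True)])"
    "t s (Lf y j) = (if y \<in> A then hair y s @ [(Lf (y, 0) j, True)] @ winv (hair y s)
       else [(Lf (y, s) j, True)])" for s y j
    by (simp_all add: t_def)
  have al_simps: "al Ctr = [(Ctr, True)]"
    "al (Piv (y, s)) = (if y \<in> A
       then if s = 0 then pw (Piv y) b else tr s @ winv (pw (Piv y) s)
       else tr s @ [(Piv y, True)] @ winv (tr s))"
    "al (Lf (y, s) j) = (if y \<in> A then [(Lf y j, True)]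
       else tr s @ [(Lf y j, True)] @ winv (tr s))" for s y j
    by (simp_all add: al_def)
  interpret raag_transducer ?E ?E' "{..<b}" "cyc_nx b \<phi>" "cyc_pv b \<phi>" t
  proof (rule raag_transducer_cyclic[OF b])
    fix u v s assume "?E u v" and s: "s < b"
    then show "raag_eq ?E' (t s u @ t (cyc_nx b \<phi> u s) v) (t s v @ t (cyc_nx b \<phi> v s) u)"
    proof (cases rule: star_E_cases)
      case (center y)
      have P: "commute ?E' [(Ctr, True)] [(Piv (y, s'), True)]" if "y \<noteq> a\<^sub>0 \<or> s' = 0" "s' < b" for s'
        using that center(1) by (intro commute_edge star_E_Ctr) (auto simp: Y')
      have "commute ?E' [(Ctr, True)] (t s (Piv y))"
      proof (cases "y \<in> A")
        case True
        show ?thesis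
        proof (cases "Suc s = b")
          case last: True
          show ?thesis unfolding t_simps if_P[OF True] if_P[OF last]
            using P[of 0] b by (intro commute_append hair_comm[OF center(1) s]) simp
        next
          case False
          then have "Suc s < b" using s by simp
          then show ?thesis unfolding t_simps if_P[OF True] if_not_P[OF False]
            by (intro commute_append commute_winv hair_comm[OF center(1)] s)
        qed
      next
        case False
        then show ?thesis using P[of s] s A by (auto simp: t_simps)
      qed
      then show ?thesis
        by (simp add: center nx_other commute_def) (simp add: t_simps)
    next
      case (leaf y j)
      show ?thesis
      proof (cases "y \<in> A")
        case True
        have L: "raag_eq ?E' ([(Piv (y, 0), True)] @ [(Lf (y, 0) j, True)])
            ([(Lf (y, 0) j, True)] @ [(Piv (y, 0), True)])"
          using leaf b by (intro raag_eq_swap star_E_Lf) (auto simp: Y' d')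
        show ?thesis
        proof (cases "Suc s = b")
          case last: True
          have "raag_eq ?E' (hair y s @ ([(Piv (y, 0), True)] @ [(Lf (y, 0) j, True)]) @ [])
              (hair y s @ ([(Lf (y, 0) j, True)] @ [(Piv (y, 0), True)]) @ [])"
            by (rule raag_eq_context[OF L])
          also have "\<dots> = (hair y s @ [(Lf (y, 0) j, True)]) @ [(Piv (y, 0), True)]" by simp
          also have "raag_eq ?E' \<dots>
              ((hair y s @ [(Lf (y, 0) j, True)]) @ (winv (hair y s) @ hair y s) @ [(Piv (y, 0), True)])"
            by (rule raag_eq_sym[OF raag_eq_drop]) simp
          finally show ?thesis
            by (simp add: leaf nx_A[OF True] nx_other last t_simps True hair_0)
        next
          case False
          \<comment> \<open>Both orders reduce to \<open>?h @ ?l @ winv ?h'\<close>: in each, the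
            hair next to the leaf cancels against the output of the pivot or is inserted by such a
            cancellation.\<close>
          let ?h = "hair y s" and ?h' = "hair y (Suc s)" and ?l = "[(Lf (y, 0) j, True)]"
          have "raag_eq ?E' (?h @ (winv ?h' @ ?h') @ ?l @ winv ?h') (?h @ ?l @ winv ?h')"
            by (rule raag_eq_drop) simp
          also have "?h @ ?l @ winv ?h' = (?h @ ?l) @ winv ?h'" by simp
          also have "raag_eq ?E' \<dots> ((?h @ ?l) @ (winv ?h @ ?h) @ winv ?h')"
            by (rule raag_eq_sym[OF raag_eq_drop]) simp
          finally show ?thesis
            by (simp add: leaf nx_A[OF True] nx_other False t_simps True)
        qed
      next
        case False
        then have "y \<noteq> a\<^sub>0" using A by auto
        then have "raag_eq ?E' ([(Piv (y, s), True)] @ [(Lf (y, s) j, True)])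
            ([(Lf (y, s) j, True)] @ [(Piv (y, s), True)])"
          using leaf s False by (intro raag_eq_swap star_E_Lf) (auto simp: Y' d')
        then show ?thesis by (simp add: leaf nx_B[OF False] nx_other t_simps False)
      qed
    qed
  qed
  \<comment> \<open>In the group \<open>y\<^sup>s\<close> is the inverse of
    \<open>a\<^sub>0\<^sup>s y\<^sup>-\<^sup>s\<close> followed by the transversal word
    \<open>a\<^sub>0\<^sup>s\<close>; accordingly the outputs telescope to the inverse hair.\<close>
  have pw_less: "run 0 (pw (Piv y) s) = s \<and> raag_eq ?E' (out 0 (pw (Piv y) s)) (winv (hair y s))"
    if "y \<in> A" "s < b" for y s
    using that(2)
  proof (induction s)
    case (Suc s)
    then have IH: "run 0 (pw (Piv y) s) = s" "raag_eq ?E' (out 0 (pw (Piv y) s)) (winv (hair y s))"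
      by auto
    have "raag_eq ?E' (out 0 (pw (Piv y) s) @ (hair y s @ winv (hair y (Suc s))))
        (winv (hair y s) @ (hair y s @ winv (hair y (Suc s))))"
      by (rule raag_eq_append[OF IH(2)]) simp
    also have "\<dots> = [] @ (winv (hair y s) @ hair y s) @ winv (hair y (Suc s))" by simp
    also have "raag_eq ?E' \<dots> ([] @ winv (hair y (Suc s)))"
      by (rule raag_eq_drop) simp
    finally show ?case
      using Suc.prems that(1) IH(1) by (simp add: pw_Suc nx_A t_simps)
  qed (simp add: hair_0)
  have pw_b: "run 0 (pw (Piv y) b) = 0 \<and> raag_eq ?E' (out 0 (pw (Piv y) b)) [(Piv (y, 0), True)]"
    if "y \<in> A" for y
  proof -
    define s where "s = b - 1"
    have s: "s < b" "Suc s = b" using b by (auto simp: s_def)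
    have IH: "run 0 (pw (Piv y) s) = s" "raag_eq ?E' (out 0 (pw (Piv y) s)) (winv (hair y s))"
      using pw_less[OF that s(1)] by auto
    have split_b: "pw (Piv y) b = pw (Piv y) s @ [(Piv y, True)]"
      using pw_Suc[of "Piv y" s] s(2) by simp
    have "raag_eq ?E' (out 0 (pw (Piv y) s) @ (hair y s @ [(Piv (y, 0), True)]))
        (winv (hair y s) @ (hair y s @ [(Piv (y, 0), True)]))"
      by (rule raag_eq_append[OF IH(2)]) simp
    also have "\<dots> = [] @ (winv (hair y s) @ hair y s) @ [(Piv (y, 0), True)]" by simp
    also have "raag_eq ?E' \<dots> ([] @ [(Piv (y, 0), True)])"
      by (rule raag_eq_drop) simp
    finally show ?thesis
      unfolding split_b using that IH(1) s(2) by (simp add: nx_A t_simps)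
  qed
  have pw_back: "run s (winv (pw (Piv y) s)) = 0 \<and> raag_eq ?E' (out s (winv (pw (Piv y) s))) (hair y s)"
    if "y \<in> A" "s < b" for y s
  proof -
    have "raag_eq ?E' (out s (winv (pw (Piv y) s))) (winv (out 0 (pw (Piv y) s)))"
      using out_winv[of 0 "pw (Piv y) s"] pw_less[OF that] b by simp
    also have "raag_eq ?E' \<dots> (winv (winv (hair y s)))"
      using pw_less[OF that] by (intro raag_eq_winv) simp
    finally show ?thesis
      using run_winv[of 0 "pw (Piv y) s"] pw_less[OF that] b by simp
  qed
  have run_tr: "run 0 (tr s) = s" "raag_eq ?E' (out 0 (tr s)) []"
    and run_back: "run s (winv (tr s)) = 0" "raag_eq ?E' (out s (winv (tr s))) []" if "s < b" for s
    using pw_less[OF A(2) that] pw_back[OF A(2) that] by (auto simp: tr_def hair_0)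
  \<comment> \<open>Up to relations \<open>tr s\<close> outputs nothing and moves to state
    \<open>s\<close>, so the conjugate outputs what \<open>v\<close> outputs in that state.\<close>
  have conj: "run 0 (tr s @ [(v, True)] @ winv (tr s)) = 0 \<and>
      raag_eq ?E' (out 0 (tr s @ [(v, True)] @ winv (tr s))) (t s v)"
    if "s < b" "cyc_nx b \<phi> v s = s" for v s
    using raag_eq_append[OF run_tr(2)[OF that(1)]
        raag_eq_append[OF raag_eq_refl run_back(2)[OF that(1)]], of "t s v"] run_tr(1)[OF that(1)]
      run_back(1)[OF that(1)] that(2) by simp
  \<comment> \<open>This includes the cases of an empty hair, where the right-hand side cancels as
    well.\<close>
  have al_hair: "raag_eq ?E (subst al (hair y s)) (tr s @ winv (pw (Piv y) s))" if "y \<in> A" for y s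
    using that by (auto simp: hair_def al_simps tr_def intro: raag_eq_sym)
  have tr_words: "tr s \<in> raag_words (star_V Y d)" for s
    using a\<^sub>0 by (simp add: tr_def)
  have tr_comm: "commute ?E [(Ctr, True)] (tr s)" for s
    unfolding tr_def using a\<^sub>0 by (intro commute_pw_edge star_E_Ctr)
  interpret raag_cover ?E ?E' "{..<b}" "cyc_nx b \<phi>" "cyc_pv b \<phi>" t "star_V Y d"
    "star_V Y' d'" 0 al tr
  proof unfold_locales
    fix v s assume v: "v \<in> star_V Y d" and "s \<in> {..<b}"
    then have s: "s < b" by simp
    show "t s v \<in> raag_words (star_V Y' d')"
    proof (cases v)
      case (Piv y)
      then show ?thesis using v s b A hair_words by (auto simp: t_simps Y')
    next
      case (Lf y j)
      then show ?thesis using v s b A hair_words by (auto simp: t_simps Y' d')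
    qed (simp add: t_simps)
    show "raag_eq ?E (subst al (t s v)) (tr s @ [(v, True)] @ winv (tr (cyc_nx b \<phi> v s)))"
    proof (cases v)
      case Ctr
      have "raag_eq ?E [(Ctr, True)] (tr s @ [(Ctr, True)] @ winv (tr s))"
        by (rule raag_eq_sym[OF raag_eq_conj_commute[OF commute_sym[OF tr_comm]]])
      then show ?thesis by (simp add: Ctr nx_other t_simps al_simps)
    next
      case (Piv y)
      show ?thesis
      proof (cases "y \<in> A")
        case True
        let ?p = "pw (Piv y) s"
        note h = al_hair[OF True]
        show ?thesis
        proof (cases "Suc s = b")
          case last: True
          have "raag_eq ?E (subst al (hair y s) @ pw (Piv y) b) ((tr s @ winv ?p) @ pw (Piv y) b)"
            by (rule raag_eq_append[OF h]) simp
          also have "\<dots> = tr s @ (winv ?p @ ?p) @ [(Piv y, True)]"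
            using last by (auto simp: pw_Suc)
          also have "raag_eq ?E \<dots> (tr s @ [(Piv y, True)])"
            by (rule raag_eq_drop) simp
          finally show ?thesis
            by (simp add: Piv t_simps True last nx_A[OF True] al_simps tr_def)
        next
          case False
          have "raag_eq ?E (subst al (hair y s) @ winv (subst al (hair y (Suc s))))
              ((tr s @ winv ?p) @ winv (tr (Suc s) @ winv (pw (Piv y) (Suc s))))"
            by (intro raag_eq_append raag_eq_winv h)
          also have "\<dots> = tr s @ (winv ?p @ ?p) @ [(Piv y, True)] @ winv (tr (Suc s))"
            by (simp add: pw_Suc winv_Cons)
          also have "raag_eq ?E \<dots> (tr s @ [(Piv y, True)] @ winv (tr (Suc s)))"
            by (rule raag_eq_drop) simp
          finally show ?thesis
            by (simp add: Piv t_simps True False nx_A[OF True])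
        qed
      next
        case False
        then show ?thesis by (simp add: Piv t_simps nx_B al_simps)
      qed
    next
      case (Lf y j)
      show ?thesis
      proof (cases "y \<in> A")
        case True
        let ?p = "pw (Piv y) s" and ?l = "[(Lf y j, True)]"
        note h = al_hair[OF True, of s]
        have "commute ?E ?l (winv ?p)"
          using v Lf by (intro commute_winv commute_pw_edge star_E_Lf) auto
        from raag_eq_conj_commute[OF commute_sym[OF this]]
        have c: "raag_eq ?E (winv ?p @ ?l @ ?p) ?l" by simp
        have "raag_eq ?E (subst al (hair y s) @ ?l @ winv (subst al (hair y s)))
            ((tr s @ winv ?p) @ ?l @ winv (tr s @ winv ?p))"
          by (intro raag_eq_append raag_eq_winv h raag_eq_refl)
        also have "\<dots> = tr s @ (winv ?p @ ?l @ ?p) @ winv (tr s)" by simp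
        also have "raag_eq ?E \<dots> (tr s @ ?l @ winv (tr s))"
          by (rule raag_eq_context[OF c])
        finally show ?thesis by (simp add: Lf t_simps True nx_other al_simps)
      next
        case False
        then show ?thesis by (simp add: Lf t_simps nx_other al_simps)
      qed
    qed
  next
    fix v assume v: "v \<in> star_V Y' d'"
    show "al v \<in> raag_words (star_V Y d)"
      using v tr_words
      by (cases v) (auto simp: al_simps Y' d' split: if_splits)
    have "run 0 (al v) = 0 \<and> raag_eq ?E' (out 0 (al v)) [(v, True)]"
    proof (cases v)
      case Ctr
      then show ?thesis by (simp add: al_simps nx_other t_simps)
    next
      case (Piv z)
      obtain y s where z: "z = (y, s)" by force
      have ys: "y \<in> Y" "s < b" "y = a\<^sub>0 \<longrightarrow> s = 0" using v by (auto simp: Piv z Y')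
      consider "y \<notin> A" | "y \<in> A" "s = 0" | "y \<in> A" "s \<noteq> 0" by blast
      then show ?thesis
      proof cases
        case 1
        then show ?thesis using conj[OF ys(2) nx_B[OF 1]] by (simp add: Piv z al_simps t_simps)
      next
        case 2
        then show ?thesis using pw_b by (simp add: Piv z al_simps)
      next
        case 3
        then show ?thesis
          using raag_eq_append[OF run_tr(2)[OF ys(2)] conjunct2[OF pw_back[OF 3(1) ys(2)]]] ys
            run_tr(1)[OF ys(2)] pw_back[OF 3(1) ys(2)]
          by (auto simp: Piv z al_simps hair_def)
      qed
    next
      case (Lf z j)
      obtain y s where z: "z = (y, s)" by force
      have ys: "y \<in> Y" "s < b" "y \<in> A \<longrightarrow> s = 0" using v by (auto simp: Lf z Y' d' split: if_splits)
      then show ?thesis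
        using conj[OF ys(2) nx_other(2)[of y j]]
        by (cases "y \<in> A") (auto simp: Lf z al_simps t_simps nx_other hair_0)
    qed
    then show "run 0 (al v) = 0" "raag_eq ?E' (out 0 (al v)) [(v, True)]" by auto
  next
    fix u v assume "?E' u v"
    then show "commute ?E (al u) (al v)"
    proof (cases rule: star_E_cases)
      case (center z)
      obtain y s where z: "z = (y, s)" by force
      have y: "y \<in> Y" using center by (simp add: z Y')
      have p: "commute ?E [(Ctr, True)] (pw (Piv y) n)" for n
        using y by (intro commute_pw_edge star_E_Ctr)
      have q: "commute ?E [(Ctr, True)] [(Piv y, True)]"
        using y by (intro commute_edge star_E_Ctr)
      have "commute ?E [(Ctr, True)] (al (Piv z))"
        unfolding z al_simps
        by (auto intro!: p q commute_append commute_winv tr_comm simp del: append_Cons append_Nil)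
      then show ?thesis by (simp add: center al_simps)
    next
      case (leaf z j)
      obtain y s where z: "z = (y, s)" by force
      have ys: "y \<in> Y" "j < d y" "y \<in> A \<longrightarrow> s = 0"
        using leaf by (auto simp: z Y' d' split: if_splits)
      have edge: "?E (Piv y) (Lf y j)" using ys by (intro star_E_Lf)
      show ?thesis
      proof (cases "y \<in> A")
        case True
        then show ?thesis using ys commute_pw_edge(1)[of ?E "Piv y" "Lf y j"] edge by (simp add: leaf z al_simps)
      next
        case False
        then show ?thesis using commute_conj[OF commute_edge[of ?E "Piv y" "Lf y j"]] edge by (simp add: leaf z al_simps)
      qed
    qed
  qed (use b in \<open>auto simp: tr_def\<close>)
  show ?thesis
    unfolding star_RAAG_def Y'_def[symmetric] d'_def[symmetric] by (rule fi_embeds_RAAG)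
qed

subsection \<open>Reduction to the multiset of degrees\<close>

text \<open>Equal multisets of degrees give a degree-preserving bijection: any bijection
  \<open>e\<close>, corrected by a permutation \<open>p\<close> of \<open>Y\<close>. It relabels one
  tree as the other.\<close>

lemma fi_embeds_star_RAAG_cong:
  assumes fin: "finite Y" "finite Y'"
    and eq: "image_mset d (mset_set Y) = image_mset d' (mset_set Y')"
  shows "fi_embeds (star_RAAG Y d) (star_RAAG Y' d')"
proof -
  have "card Y = card Y'" using arg_cong[OF eq, of size] by simp
  then obtain e where e: "bij_betw e Y Y'" using fin by (metis finite_same_card_bij)
  have "mset_set Y' = image_mset e (mset_set Y)"
    using e by (simp add: image_mset_mset_set bij_betw_def)
  then have "image_mset d (mset_set Y) = image_mset (d' \<circ> e) (mset_set Y)"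
    using eq by (simp add: multiset.map_comp)
  then obtain p where p: "p permutes Y" "\<forall>y\<in>Y. d y = (d' \<circ> e) (p y)"
    using image_mset_eq_implies_permutes[OF fin(1)] by metis
  define h where "h = e \<circ> p"
  define h' where "h' = inv_into Y h"
  have h: "bij_betw h Y Y'"
    unfolding h_def using permutes_imp_bij[OF p(1)] e by (rule bij_betw_trans)
  have d: "d' (h y) = d y" if "y \<in> Y" for y
    using p(2) that by (simp add: h_def)
  have h_in: "h y \<in> Y'" "h' (h y) = y" if "y \<in> Y" for y
    using that h by (auto simp: h'_def bij_betw_def)
  have h'_in: "h' y \<in> Y" "h (h' y) = y" if "y \<in> Y'" for y
    using that h by (auto simp: h'_def bij_betw_def inv_into_into f_inv_into_f)
  have d': "d (h' y) = d' y" if "y \<in> Y'" for y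
    using d[OF h'_in(1)[OF that]] h'_in(2)[OF that] by simp
  show ?thesis
    unfolding star_RAAG_def
  proof (rule fi_embeds_RAAG_relabel[where f = "map_star_vert h" and g = "map_star_vert h'"])
    fix v assume v: "v \<in> star_V Y d"
    show "map_star_vert h v \<in> star_V Y' d'" "map_star_vert h' (map_star_vert h v) = v"
      using v by (cases v; auto simp: h_in d)+
  next
    fix v assume v: "v \<in> star_V Y' d'"
    show "map_star_vert h' v \<in> star_V Y d" "map_star_vert h (map_star_vert h' v) = v"
      using v by (cases v; auto simp: h'_in d')+
  next
    fix x y assume "star_E Y d x y"
    then show "star_E Y' d' (map_star_vert h x) (map_star_vert h y) \<or>
        star_E Y' d' (map_star_vert h y) (map_star_vert h x)"
      by (cases rule: star_E_cases) (auto simp: star_E_def h_in d)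
  next
    fix x y assume "star_E Y' d' x y"
    then show "star_E Y d (map_star_vert h' x) (map_star_vert h' y) \<or>
        star_E Y d (map_star_vert h' y) (map_star_vert h' x)"
      by (cases rule: star_E_cases) (auto simp: star_E_def h'_in d')
  qed
qed

text \<open>A standard model that gives all trees the same type; an entry 0 stands for a hair, and
  sorting merely fixes an enumeration.\<close>

definition mset_RAAG :: "nat multiset \<Rightarrow> (nat star_vert \<times> bool) list set monoid" where
  "mset_RAAG M = star_RAAG {..<size M} (nth (sorted_list_of_multiset M))"

lemma group_mset_RAAG: "group (mset_RAAG M)"
  by (simp add: mset_RAAG_def group_star_RAAG)

lemma image_mset_nth: "image_mset (nth xs) (mset_set {..<length xs}) = mset xs"
proof -
  have "mset xs = mset (map (nth xs) [0..<length xs])" by (simp add: map_nth)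
  then show ?thesis by (simp add: atLeast0LessThan)
qed

lemma degrees_mset_RAAG:
  "image_mset (nth (sorted_list_of_multiset M)) (mset_set {..<size M}) = M"
  using image_mset_nth[of "sorted_list_of_multiset M"]
  by (metis mset_sorted_list_of_multiset size_mset)

lemma fi_embeds_mset_RAAG:
  assumes "finite Y" "image_mset d (mset_set Y) = M"
  shows "fi_embeds (mset_RAAG M) (star_RAAG Y d)" "fi_embeds (star_RAAG Y d) (mset_RAAG M)"
  unfolding mset_RAAG_def using assms degrees_mset_RAAG[of M]
  by (auto intro: fi_embeds_star_RAAG_cong)

lemma fi_embeds_mset_RAAG_center:
  assumes "0 < b"
  shows "fi_embeds (mset_RAAG M) (mset_RAAG (image_mset (\<lambda>x. x * b) M))"
proof -
  let ?d = "nth (sorted_list_of_multiset M)"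
  have "fi_embeds (mset_RAAG M) (star_RAAG {..<size M} (\<lambda>i. ?d i * b))"
    unfolding mset_RAAG_def by (rule fi_embeds_star_RAAG_center[OF assms])
  moreover have "image_mset (\<lambda>i. ?d i * b) (mset_set {..<size M}) = image_mset (\<lambda>x. x * b) M"
    using arg_cong[OF degrees_mset_RAAG[of M], of "image_mset (\<lambda>x. x * b)"]
    by (simp add: multiset.map_comp o_def)
  then have "fi_embeds (star_RAAG {..<size M} (\<lambda>i. ?d i * b)) (mset_RAAG (image_mset (\<lambda>x. x * b) M))"
    by (intro fi_embeds_mset_RAAG) auto
  ultimately show ?thesis by (rule fi_embeds_trans[OF group_mset_RAAG])
qed

lemma image_mset_Times_lessThan:
  assumes "finite B"
  shows "image_mset (\<lambda>z. d (fst z)) (mset_set (B \<times> {..<b})) =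
    repeat_mset b (image_mset d (mset_set B))"
proof (induction b)
  case (Suc b)
  have "B \<times> {..<Suc b} = B \<times> {..<b} \<union> (\<lambda>y. (y, b)) ` B" by auto
  moreover have "mset_set ((\<lambda>y. (y, b)) ` B) = image_mset (\<lambda>y. (y, b)) (mset_set B)"
    by (simp add: image_mset_mset_set inj_on_def)
  moreover have "mset_set (B \<times> {..<b} \<union> (\<lambda>y. (y, b)) ` B) =
      mset_set (B \<times> {..<b}) + mset_set ((\<lambda>y. (y, b)) ` B)"
    using assms by (intro mset_set_Union) auto
  ultimately show ?case
    using Suc by (simp add: multiset.map_comp o_def add.commute)
qed simp

lemma degrees_unwrap:
  assumes "finite Y" "A \<subseteq> Y" "a\<^sub>0 \<in> A" "0 < b"
  shows "image_mset (unwrap_degree d A) (mset_set (unwrap_pivots Y a\<^sub>0 b)) =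
    image_mset d (mset_set A) + repeat_mset b (image_mset d (mset_set (Y - A))) +
    replicate_mset ((b - 1) * (card A - 1)) 0"
proof -
  have fin: "finite A" using assms by (meson finite_subset)
  \<comment> \<open>Three disjoint pieces: \<open>A\<close> at level 0, the \<open>b\<close> copies
    of each pivot outside \<open>A\<close>, and the new hairs, which arise from the members of
    \<open>A\<close> other than \<open>a\<^sub>0\<close>.\<close>
  have Y: "unwrap_pivots Y a\<^sub>0 b = ((\<lambda>y. (y, 0)) ` A \<union> (Y - A) \<times> {..<b}) \<union> (A - {a\<^sub>0}) \<times> {1..<b}"
    using assms by (auto simp: unwrap_pivots_def)
  have "mset_set (unwrap_pivots Y a\<^sub>0 b) = mset_set ((\<lambda>y. (y, 0::nat)) ` A) + mset_set ((Y - A) \<times> {..<b})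
      + mset_set ((A - {a\<^sub>0}) \<times> {1..<b})"
  proof -
    have "mset_set (((\<lambda>y. (y, 0::nat)) ` A \<union> (Y - A) \<times> {..<b}) \<union> (A - {a\<^sub>0}) \<times> {1..<b}) =
        mset_set ((\<lambda>y. (y, 0)) ` A \<union> (Y - A) \<times> {..<b}) + mset_set ((A - {a\<^sub>0}) \<times> {1..<b})"
      using assms fin by (intro mset_set_Union) auto
    moreover have "mset_set ((\<lambda>y. (y, 0::nat)) ` A \<union> (Y - A) \<times> {..<b}) =
        mset_set ((\<lambda>y. (y, 0)) ` A) + mset_set ((Y - A) \<times> {..<b})"
      using assms fin by (intro mset_set_Union) auto
    ultimately show ?thesis unfolding Y by simp
  qed
  moreover have "image_mset (unwrap_degree d A) (mset_set ((\<lambda>y. (y, 0)) ` A)) = image_mset d (mset_set A)"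
    by (simp add: image_mset_mset_set[symmetric] inj_on_def multiset.map_comp o_def unwrap_degree_def)
  moreover have "image_mset (unwrap_degree d A) (mset_set ((Y - A) \<times> {..<b})) =
      image_mset (\<lambda>z. d (fst z)) (mset_set ((Y - A) \<times> {..<b}))"
    using assms by (intro image_mset_cong) (auto simp: unwrap_degree_def)
  moreover have "image_mset (unwrap_degree d A) (mset_set ((A - {a\<^sub>0}) \<times> {1..<b})) =
      image_mset (\<lambda>_. 0) (mset_set ((A - {a\<^sub>0}) \<times> {1..<b}))"
    using fin by (intro image_mset_cong) (auto simp: unwrap_degree_def)
  moreover have "\<dots> = replicate_mset ((b - 1) * (card A - 1)) 0"
    using fin assms(3) by (simp add: image_mset_const_eq card_cartesian_product mult.commute)
  ultimately show ?thesis
    using assms(1) by (simp add: image_mset_Times_lessThan)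
qed

lemma fi_embeds_mset_RAAG_unwrap:
  assumes "MA \<noteq> {#}" "0 < b"
  shows "fi_embeds (mset_RAAG (MA + MB))
    (mset_RAAG (MA + repeat_mset b MB + replicate_mset ((b - 1) * (size MA - 1)) 0))"
proof -
  \<comment> \<open>Listing \<open>MA\<close> first makes \<open>A\<close> an initial segment of the
    indices; index 0 then serves as \<open>a\<^sub>0\<close>, as \<open>MA\<close> is
    nonempty.\<close>
  obtain xs ys where xs: "mset xs = MA" and ys: "mset ys = MB" by (metis ex_mset)
  define n where "n = length xs + length ys"
  define d where "d = nth (xs @ ys)"
  have pos: "0 < length xs" using assms(1) xs by auto
  have dY: "image_mset d (mset_set {..<n}) = MA + MB"
    using image_mset_nth[of "xs @ ys"] xs ys by (simp add: d_def n_def)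
  have dA: "image_mset d (mset_set {..<length xs}) = MA"
  proof -
    have "image_mset d (mset_set {..<length xs}) = image_mset (nth xs) (mset_set {..<length xs})"
      by (intro image_mset_cong) (auto simp: d_def nth_append)
    then show ?thesis using image_mset_nth[of xs] xs by simp
  qed
  have "{..<n} = {..<length xs} \<union> ({..<n} - {..<length xs})" by (auto simp: n_def)
  then have "mset_set {..<n} = mset_set {..<length xs} + mset_set ({..<n} - {..<length xs})"
    using mset_set_Union[of "{..<length xs}" "{..<n} - {..<length xs}"] by auto
  then have dB: "image_mset d (mset_set ({..<n} - {..<length xs})) = MB"
    using dA dY by simp
  let ?Y' = "unwrap_pivots {..<n} 0 b" and ?d' = "unwrap_degree d {..<length xs}"
  have "fi_embeds (mset_RAAG (MA + MB)) (star_RAAG {..<n} d)"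
    by (rule fi_embeds_mset_RAAG[OF _ dY]) simp
  moreover have "fi_embeds (star_RAAG {..<n} d) (star_RAAG ?Y' ?d')"
    using pos assms(2) by (intro fi_embeds_star_RAAG_unwrap) (auto simp: n_def)
  moreover have "fi_embeds (star_RAAG ?Y' ?d')
      (mset_RAAG (MA + repeat_mset b MB + replicate_mset ((b - 1) * (size MA - 1)) 0))"
  proof (rule fi_embeds_mset_RAAG)
    have "?Y' \<subseteq> {..<n} \<times> {..<b}" by (auto simp: unwrap_pivots_def)
    then show "finite ?Y'" by (rule finite_subset) simp
    have "{..<length xs} \<subseteq> {..<n}" by (auto simp: n_def)
    from degrees_unwrap[of "{..<n}" "{..<length xs}" 0 b d, OF _ this]
    show "image_mset ?d' (mset_set ?Y') =
        MA + repeat_mset b MB + replicate_mset ((b - 1) * (size MA - 1)) 0"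
      using pos assms(2) dA dB xs by auto
  qed
  ultimately show ?thesis
    by (meson fi_embeds_trans group_mset_RAAG)
qed

section \<open>The commensurability theorem\<close>

definition tree_mset :: "nat \<Rightarrow> (nat \<Rightarrow> nat) \<Rightarrow> (nat \<Rightarrow> nat) \<Rightarrow> nat \<Rightarrow> nat multiset" where
  "tree_mset l d k q = replicate_mset q 0 + (\<Sum>i<l. replicate_mset (k i) (d i))"

lemma tree_mset_cong:
  "(\<And>i. i < l \<Longrightarrow> d i = d' i) \<Longrightarrow> (\<And>i. i < l \<Longrightarrow> k i = k' i) \<Longrightarrow> tree_mset l d k q = tree_mset l d' k' q"
  by (simp add: tree_mset_def)

lemma image_mset_sum: "image_mset f (sum g A) = (\<Sum>i\<in>A. image_mset f (g i))"
  by (induction A rule: infinite_finite_induct) auto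

lemma image_mset_tree_mset: "image_mset (\<lambda>x. x * b) (tree_mset l d k q) = tree_mset l (\<lambda>i. d i * b) k q"
  by (simp add: tree_mset_def image_mset_sum)

lemma size_multiset_sum:
  fixes g :: "'i \<Rightarrow> 'a multiset"
  shows "size (sum g A) = (\<Sum>i\<in>A. size (g i))"
  by (induction A rule: infinite_finite_induct) auto

lemma replicate_mset_add: "replicate_mset (a + b) x = replicate_mset a x + replicate_mset b x"
  by (induction a) auto

lemma repeat_mset_replicate: "repeat_mset b (replicate_mset a x) = replicate_mset (a * b) x"
  by (rule multiset_eqI) simp

lemma group_tree4_RAAG: "group (tree4_RAAG l d k q)"
  by (simp add: tree4_RAAG_def group_RAAG)

lemma fi_embeds_tree4_RAAG: "fi_embeds (tree4_RAAG l d k q) (mset_RAAG (tree_mset l d k q))"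
proof -
  define Y where "Y = Hair ` {..<q} \<union> (\<Union>i<l. Pivot i ` {..<k i})"
  \<comment> \<open>Hairs receive degree 0, so no leaf sits at a hair, and the value
    \<open>Center\<close> that \<open>g\<close> gives to such a leaf is a mere default.\<close>
  define e where "e v = (case v of Pivot i j \<Rightarrow> d i | _ \<Rightarrow> 0)" for v
  define f where "f v = (case v of Center \<Rightarrow> Ctr | Leaf i j u \<Rightarrow> Lf (Pivot i j) u | _ \<Rightarrow> Piv v)" for v
  define g where "g v = (case v of Ctr \<Rightarrow> Center | Piv y \<Rightarrow> y
    | Lf y u \<Rightarrow> (case y of Pivot i j \<Rightarrow> Leaf i j u | _ \<Rightarrow> Center))" for v
  have Y: "Hair j \<in> Y \<longleftrightarrow> j < q" "Pivot i j \<in> Y \<longleftrightarrow> i < l \<and> j < k i" for i j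
    by (auto simp: Y_def)
  have Y_cases: "(\<exists>j<q. y = Hair j) \<or> (\<exists>i<l. \<exists>j<k i. y = Pivot i j)" if "y \<in> Y" for y
    using that by (auto simp: Y_def)
  have "fi_embeds (tree4_RAAG l d k q) (star_RAAG Y e)"
    unfolding tree4_RAAG_def star_RAAG_def
  proof (rule fi_embeds_RAAG_relabel[where f = f and g = g])
    fix v assume "v \<in> tree4_vertices l d k q"
    then show "f v \<in> star_V Y e" "g (f v) = v"
      by (auto simp: tree4_vertices_def f_def g_def Y e_def)
  next
    fix v assume "v \<in> star_V Y e"
    then show "g v \<in> tree4_vertices l d k q" "f (g v) = v"
      by (auto simp: tree4_vertices_def star_V_def f_def g_def e_def dest!: Y_cases)
  next
    fix x y assume "tree4_adj l d k q x y"
    then show "star_E Y e (f x) (f y) \<or> star_E Y e (f y) (f x)"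
      by (auto simp: tree4_adj_def tree4_adj0_def star_E_def f_def Y e_def)
  next
    fix x y assume "star_E Y e x y"
    then show "tree4_adj l d k q (g x) (g y) \<or> tree4_adj l d k q (g y) (g x)"
    proof (cases rule: star_E_cases)
      case (center z)
      then show ?thesis
        using Y_cases[OF center(1)] by (auto simp: tree4_adj_def tree4_adj0_def g_def)
    next
      case (leaf z u)
      with Y_cases[OF leaf(1)] obtain i j where "i < l" "j < k i" "z = Pivot i j" "u < d i"
        by (auto simp: e_def)
      then show ?thesis
        using leaf by (simp add: tree4_adj_def tree4_adj0_def g_def)
    qed
  qed
  moreover have "finite Y" by (simp add: Y_def)
  moreover have "image_mset e (mset_set Y) = tree_mset l d k q"
  proof -
    have pivots: "image_mset e (mset_set (\<Union>i<l. Pivot i ` {..<k i})) =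
        (\<Sum>i<l. replicate_mset (k i) (d i))"
    proof (induction l)
      case (Suc l)
      have "mset_set (Pivot l ` {..<k l} \<union> (\<Union>i<l. Pivot i ` {..<k i})) =
          mset_set (Pivot l ` {..<k l}) + mset_set (\<Union>i<l. Pivot i ` {..<k i})"
        by (intro mset_set_Union) auto
      moreover have "image_mset e (mset_set (Pivot l ` {..<k l})) = replicate_mset (k l) (d l)"
        by (simp add: image_mset_mset_set[symmetric] inj_on_def multiset.map_comp o_def e_def
            image_mset_const_eq)
      ultimately show ?case using Suc by (simp add: lessThan_Suc add.commute)
    qed simp
    have "mset_set Y = mset_set (Hair ` {..<q}) + mset_set (\<Union>i<l. Pivot i ` {..<k i})"
      unfolding Y_def by (intro mset_set_Union) auto
    moreover have "image_mset e (mset_set (Hair ` {..<q})) = replicate_mset q 0"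
      by (simp add: image_mset_mset_set[symmetric] inj_on_def multiset.map_comp o_def e_def
          image_mset_const_eq)
    ultimately show ?thesis using pivots by (simp add: tree_mset_def)
  qed
  ultimately show ?thesis
    by (blast intro: fi_embeds_trans[OF group_tree4_RAAG] fi_embeds_mset_RAAG(2))
qed

text \<open>The rank \<open>p + \<Sum> k i\<close> of the free group on the neighbours of the center is recorded minus one:
  this is a negative Euler characteristic, hence multiplied by the degree of a cover.\<close>

lemma fi_embeds_add_hairs:
  assumes "0 < b" "p + (\<Sum>i<l. k i) = Suc N"
  shows "\<exists>p'. fi_embeds (mset_RAAG (tree_mset l e k p)) (mset_RAAG (tree_mset l e k p')) \<and>
    p' + (\<Sum>i<l. k i) = Suc (b * N) \<and> p + (b - 1) * N = p'"
proof -
  have "size (tree_mset l e k p) = Suc N"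
    using assms(2) by (simp add: tree_mset_def size_multiset_sum)
  then have "tree_mset l e k p \<noteq> {#}" by auto
  \<comment> \<open>Here \<open>A\<close> is the set of all neighbours of the center, so the only
    change is the addition of \<open>(b - 1) * N\<close> hairs.\<close>
  from fi_embeds_mset_RAAG_unwrap[OF this assms(1), of "{#}"]
  have "fi_embeds (mset_RAAG (tree_mset l e k p)) (mset_RAAG (tree_mset l e k (p + (b - 1) * N)))"
    using \<open>size _ = _\<close> by (simp add: tree_mset_def replicate_mset_add add_ac)
  moreover have "p + (b - 1) * N + (\<Sum>i<l. k i) = Suc (b * N)"
    using assms by (cases b) auto
  ultimately show ?thesis by blast
qed

text \<open>\<open>A\<close> consists of the hairs and the pivots of all types but \<open>i\<close>.
  A hair keeps \<open>A\<close> nonempty even if \<open>i\<close> is the only type, and a positive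
  \<open>p'\<close> allows the step to be repeated for the next type.\<close>

lemma fi_embeds_multiply_pivots:
  assumes "0 < b" "0 < p" "i < l" "p + (\<Sum>j<l. k j) = Suc N"
  shows "\<exists>p'>0. fi_embeds (mset_RAAG (tree_mset l e k p))
      (mset_RAAG (tree_mset l e (k(i := k i * b)) p')) \<and>
    p' + (\<Sum>j<l. (k(i := k i * b)) j) = Suc (b * N)"
proof -
  define MA where "MA = replicate_mset p 0 + (\<Sum>j\<in>{..<l} - {i}. replicate_mset (k j) (e j))"
  define K where "K = (\<Sum>j\<in>{..<l} - {i}. k j)"
  define p' where "p' = p + (b - 1) * (p + K - 1)"
  have size_MA: "size MA = p + K" by (simp add: MA_def K_def size_multiset_sum)
  have split: "(\<Sum>j<l. h j) = h i + (\<Sum>j\<in>{..<l} - {i}. h j)" for h :: "nat \<Rightarrow> 'z::comm_monoid_add"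
    using assms(3) by (intro sum.remove) auto
  have "MA \<noteq> {#}" using assms(2) by (auto simp: MA_def)
  from fi_embeds_mset_RAAG_unwrap[OF this assms(1), of "replicate_mset (k i) (e i)"]
  have "fi_embeds (mset_RAAG (MA + replicate_mset (k i) (e i)))
      (mset_RAAG (MA + replicate_mset (k i * b) (e i) + replicate_mset ((b - 1) * (p + K - 1)) 0))"
    by (simp add: size_MA repeat_mset_replicate)
  moreover have "MA + replicate_mset (k i) (e i) = tree_mset l e k p"
    by (simp add: MA_def tree_mset_def split add_ac)
  moreover have "MA + replicate_mset (k i * b) (e i) + replicate_mset ((b - 1) * (p + K - 1)) 0 =
      tree_mset l e (k(i := k i * b)) p'"
    by (simp add: MA_def tree_mset_def split p'_def replicate_mset_add add_ac)
  moreover have "p' + (\<Sum>j<l. (k(i := k i * b)) j) = Suc (b * N)"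
  proof -
    obtain p0 b0 where "p = Suc p0" "b = Suc b0" using assms(1,2) by (metis gr0_conv_Suc)
    moreover have "p + K + k i = Suc N" using assms(4) by (simp add: split K_def)
    moreover have "(\<Sum>j\<in>{..<l} - {i}. (k(i := k i * b)) j) = K"
      unfolding K_def by (intro sum.cong) auto
    ultimately show ?thesis
      unfolding split by (auto simp: p'_def algebra_simps)
  qed
  moreover have "0 < p'" using assms(2) by (simp add: p'_def)
  ultimately show ?thesis by auto
qed

text \<open>Induction on the number \<open>j\<close> of types already treated; type \<open>j\<close>
  is next, by a cover of degree \<open>r j\<close>.\<close>

lemma fi_embeds_multiply_all_pivots:
  assumes r: "\<And>i. i < l \<Longrightarrow> 0 < r i" and p: "0 < p" "p + (\<Sum>i<l. k i) = Suc N" and "j \<le> l"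
  shows "\<exists>p'>0. fi_embeds (mset_RAAG (tree_mset l e k p))
      (mset_RAAG (tree_mset l e (\<lambda>i. if i < j then k i * r i else k i) p')) \<and>
    p' + (\<Sum>i<l. if i < j then k i * r i else k i) = Suc (N * (\<Prod>i<j. r i))"
  using \<open>j \<le> l\<close>
proof (induction j)
  case 0
  have "fi_embeds (mset_RAAG (tree_mset l e k p)) (mset_RAAG (tree_mset l e k p))"
    unfolding mset_RAAG_def by (intro fi_embeds_star_RAAG_cong) auto
  then show ?case using p by auto
next
  case (Suc j)
  let ?k = "\<lambda>i. if i < j then k i * r i else k i"
  obtain p' where p': "0 < p'" "fi_embeds (mset_RAAG (tree_mset l e k p)) (mset_RAAG (tree_mset l e ?k p'))"
    "p' + (\<Sum>i<l. ?k i) = Suc (N * (\<Prod>i<j. r i))"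
    using Suc by auto
  have upd: "?k(j := ?k j * r j) = (\<lambda>i. if i < Suc j then k i * r i else k i)"
    by auto
  have j: "j < l" using Suc.prems by simp
  obtain p'' where p'': "0 < p''"
    "fi_embeds (mset_RAAG (tree_mset l e ?k p')) (mset_RAAG (tree_mset l e (?k(j := ?k j * r j)) p''))"
    "p'' + (\<Sum>i<l. (?k(j := ?k j * r j)) i) = Suc (r j * (N * (\<Prod>i<j. r i)))"
    using fi_embeds_multiply_pivots[OF r[OF j] p'(1) j p'(3), of e] by blast
  show ?case
    using p''(1) fi_embeds_trans[OF group_mset_RAAG p'(2) p''(2)] p''(3) unfolding upd
    by (intro exI[of _ p'']) (simp add: mult_ac)
qed

lemma fi_embeds_common_tree:
  assumes r: "\<And>i. i < l \<Longrightarrow> 0 < r i" and N: "0 < N" "p + (\<Sum>i<l. k i) = Suc N" and c: "0 < c"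
  shows "\<exists>p'. fi_embeds (mset_RAAG (tree_mset l e k p)) (mset_RAAG (tree_mset l e (\<lambda>i. k i * r i) p')) \<and>
    p' + (\<Sum>i<l. k i * r i) = Suc (2 * c * N * (\<Prod>i<l. r i))"
proof -
  \<comment> \<open>The factor \<open>c\<close> is left free for matching the invariants of two
    trees. The factor 2 forces at least one new hair, so that pivots can be multiplied even if
    \<open>p = 0\<close> and \<open>c = 1\<close>.\<close>
  have "0 < 2 * c" using c by simp
  obtain p1 where p1: "fi_embeds (mset_RAAG (tree_mset l e k p)) (mset_RAAG (tree_mset l e k p1))"
    "p1 + (\<Sum>i<l. k i) = Suc (2 * c * N)" "p + (2 * c - 1) * N = p1"
    using fi_embeds_add_hairs[OF \<open>0 < 2 * c\<close> N(2), of e] by blast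
  have "0 < (2 * c - 1) * N" using c N(1) by simp
  then have "0 < p1" using p1(3) by linarith
  obtain p2 where p2: "fi_embeds (mset_RAAG (tree_mset l e k p1))
      (mset_RAAG (tree_mset l e (\<lambda>i. if i < l then k i * r i else k i) p2))"
    "p2 + (\<Sum>i<l. if i < l then k i * r i else k i) = Suc (2 * c * N * (\<Prod>i<l. r i))"
    using fi_embeds_multiply_all_pivots[of l r p1 k "2 * c * N" l e] r \<open>0 < p1\<close> p1(2) by blast
  have "tree_mset l e (\<lambda>i. if i < l then k i * r i else k i) p2 = tree_mset l e (\<lambda>i. k i * r i) p2"
    by (rule tree_mset_cong) auto
  then show ?thesis
    using fi_embeds_trans[OF group_mset_RAAG p1(1) p2(1)] p2(2) by (intro exI[of _ p2]) simp
qed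

text \<open>Diameter 4 requires two pivots; hence the invariant, the number of neighbours of the
  center minus one, is positive.\<close>

lemma tree4_params_sum_ge_2:
  assumes "tree4_params l d k"
  shows "2 \<le> (\<Sum>i<l. k i)"
proof (cases "2 \<le> l")
  case True
  have "(\<Sum>i<l. 1) \<le> (\<Sum>i<l. k i)"
    using assms by (intro sum_mono) (auto simp: tree4_params_def Suc_le_eq)
  then show ?thesis using True by simp
next
  case False
  then show ?thesis using assms by (auto simp: tree4_params_def)
qed

theorem mainTheorem5:
  fixes l p q :: nat and m k n r :: "nat \<Rightarrow> nat"
  assumes "tree4_params l m k"
    and "tree4_params l n r"
    and "\<forall>i<l. \<forall>j<l. m i * n j = m j * n i"
  shows "commensurable (tree4_RAAG l m k p) (tree4_RAAG l n r q)"
proof -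
  have pos: "0 < l" "\<And>i. i < l \<Longrightarrow> 0 < m i" "\<And>i. i < l \<Longrightarrow> 0 < k i"
    "\<And>i. i < l \<Longrightarrow> 0 < n i" "\<And>i. i < l \<Longrightarrow> 0 < r i"
    using assms(1,2) by (auto simp: tree4_params_def)
  \<comment> \<open>Unwrapping the center with degrees \<open>n 0\<close> and \<open>m 0\<close>
    gives leaf numbers \<open>m i * n 0\<close> and \<open>n i * m 0\<close>, which agree by the
    proportionality of \<open>m\<close> and \<open>n\<close>.\<close>
  define e where "e = (\<lambda>i. m i * n 0)"
  have "tree_mset l (\<lambda>i. n i * m 0) r q = tree_mset l e r q"
    using assms(3) pos(1) by (intro tree_mset_cong) (auto simp: e_def mult.commute)
  then have S: "fi_embeds (tree4_RAAG l n r q) (mset_RAAG (tree_mset l e r q))"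
    using fi_embeds_trans[OF group_tree4_RAAG fi_embeds_tree4_RAAG fi_embeds_mset_RAAG_center,
        of "m 0" l n r q] pos(1,2) by (simp add: image_mset_tree_mset)
  have T: "fi_embeds (tree4_RAAG l m k p) (mset_RAAG (tree_mset l e k p))"
    using fi_embeds_trans[OF group_tree4_RAAG fi_embeds_tree4_RAAG fi_embeds_mset_RAAG_center,
        of "n 0" l m k p] pos(1,4) by (simp add: image_mset_tree_mset e_def)
  define N M where "N = p + (\<Sum>i<l. k i) - 1" and "M = q + (\<Sum>i<l. r i) - 1"
  have N: "0 < N" "p + (\<Sum>i<l. k i) = Suc N" and M: "0 < M" "q + (\<Sum>i<l. r i) = Suc M"
    using tree4_params_sum_ge_2[OF assms(1)] tree4_params_sum_ge_2[OF assms(2)]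
    by (auto simp: N_def M_def)
  have prods: "0 < (\<Prod>i<l. k i)" "0 < (\<Prod>i<l. r i)"
    using pos by (auto intro!: prod_pos)
  \<comment> \<open>The free factors are crossed: each tree receives the other one's invariant and
    its own product of pivot numbers. Both invariants become \<open>2 * M * N\<close> times both
    products.\<close>
  obtain p' where p': "fi_embeds (mset_RAAG (tree_mset l e k p)) (mset_RAAG (tree_mset l e (\<lambda>i. k i * r i) p'))"
    "p' + (\<Sum>i<l. k i * r i) = Suc (2 * (M * (\<Prod>i<l. k i)) * N * (\<Prod>i<l. r i))"
    using fi_embeds_common_tree[of l r N p k "M * (\<Prod>i<l. k i)" e] pos(5) N M(1) prods by auto
  obtain q' where q': "fi_embeds (mset_RAAG (tree_mset l e r q)) (mset_RAAG (tree_mset l e (\<lambda>i. r i * k i) q'))"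
    "q' + (\<Sum>i<l. r i * k i) = Suc (2 * (N * (\<Prod>i<l. r i)) * M * (\<Prod>i<l. k i))"
    using fi_embeds_common_tree[of l k M q r "N * (\<Prod>i<l. r i)" e] pos(3) M N(1) prods by auto
  \<comment> \<open>The invariants and the pivot numbers agree, hence so do the numbers of
    hairs.\<close>
  have "p' = q'" using p'(2) q'(2) by (simp add: mult_ac)
  then have "fi_embeds (mset_RAAG (tree_mset l e r q)) (mset_RAAG (tree_mset l e (\<lambda>i. k i * r i) p'))"
    using q'(1) by (simp add: mult.commute)
  then show ?thesis
    using fi_embeds_trans[OF group_tree4_RAAG T p'(1)] fi_embeds_trans[OF group_tree4_RAAG S]
    by (intro fi_embeds_common_imp_commensurable[OF group_tree4_RAAG group_tree4_RAAG group_mset_RAAG])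
qed

end
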